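(* Let $G=(X,\delta,m)$ be a 1-dimensional cell complex and let $\omega:X\to(0,\infty)$ be non-degenerate. Then for every $x\in X_1$, $$\kappa_\omega(x)=\max_K F_{K,\omega}(x),$$ where the maximum is taken over all cell complexes $K$ having $G$ as $1$-skeleton.
   Context: For a finite set $X$, $C(X)=\mathbb{R}^X$, and $x\in X$ is identified with its indicator function $1_x\in C(X)$. A cell complex $K=(X,\delta,m)$ consists of a finite set of cells $X=\dot\bigcup_{k\ge 0}X_k$, a linear operator $\delta:C(X)\to C(X)$ (coboundary) and a weight $m:X\to(0,\infty)$. Write $\dim(z)=k$ iff $z\in X_k$, and $x\lessdot z$ (equivalently $z\gtrdot x$) iff $\delta x(z)\ne 0$. It is required that for all $v,z,z'\in X$: $\delta v(z)\in\{-1,0,1\}$; $\delta v(z)=0$ if $\dim(z)-\dim(v)\ne 1$; if $\dim(z)\ge 1$ there exists $x\lessdot z$; and (i) for every $x\in X_1$ there is exactly one $w\in X_0$ with $\delta w(x)=1$ and exactly one $w\in X_0$ with $\delta w(x)=-1$; (ii) if $\dim(z)-\dim(v)=2$ and $\{x:v\lessdot x\lessdot z\}\ne\emptyset$, then $|\{x:v\lessdot x\lessdot z\}|=2$ and $\{\delta v(x)\,\delta x(z):x\in X\}\supseteq\{-1,1\}$ (hence $\delta\delta=0$); (iii) if $\dim(z)\ge 2$ and $x,y\lessdot z$, there is a sequence $x=x_0,\dots,x_n=y$ of cells in $\{u:u\lessdot z\}\cup\{v: v\lessdot u\lessdot z\text{ for some }u\}$ with $\delta x_i(x_{i-1})+\delta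 x_{i-1}(x_i)\ne0$ for $i=1,\dots,n$; (iv) if $\{x:x\lessdot z\}=\{x:x\lessdot z'\}$ and $\dim(z)\ge 1$, then $z=z'$. The dimension of $K$ is the maximal dimension of its cells. The $1$-skeleton of $K$ is $X_0\cup X_1$ with the restrictions of $\delta$ and $m$. $C(X)$ carries the scalar product $\langle f,g\rangle=\sum_{x\in X}f(x)g(x)m(x)$, $\delta^*$ is the adjoint of $\delta$, and $H=\delta\delta^*+\delta^*\delta$ is the Hodge Laplacian; $H$ preserves each $C(X_k)$. For $v,w\in X_0$, $v\sim w$ iff they are the two vertices of some edge $x\in X_1$, in which case $\omega(v,w)=\omega(x)$. The path distance generated by $\omega$ is $d_\omega(v,w)=\inf\{\sum_{k=1}^n\omega(v_k,v_{k-1}):v=v_0\sim\dots\sim v_n=w\}$. $\omega$ is non-degenerate if every edge $x=(v,w)\in X_1$ is the unique shortest path (with respect to $d_\omega$) between its vertices. The $\omega$-Ollivier curvature (here computed in $G$) is defined by $\omega(x)\kappa_\omega(x)=\inf\{\delta\delta^*\delta f(x): f\in C(X),\ \delta f(x)=\omega(x),\ |\delta f|\le\omega\}$. The $\omega$-Forman curvature of $x\in X_1$ in $K$ is $F_{K,\omega}(x)=Hx(x)-\sum_{y\in X_1, y\ne x}\frac{\omega(y)}{\omega(x)}|Hy(x)|$ with $H$ the Hodge Laplacian of $K$ (for $x\in X_1$ only the values of $\omega$ on edges matter, since $Hy(x)=0$ for $y\notin X_1$). *)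

theory Defs
  imports
    Complex_Main
    "HOL-Library.Extended_Real"
    "HOL-Library.Infinite_Typeclass"
    "HOL-Library.Indicator_Function"
begin

text \<open>
  The linear operator \<open>\<delta>\<close> on \<open>C(X)\<close> is stored as its matrix in the basis of indicator functions:
  \<open>incidence K v z\<close> is \<open>\<delta> 1\<^sub>v (z)\<close>, see \<open>coboundary_indicator\<close> below. All fields except
  \<open>cells\<close> are only meaningful on \<open>cells K\<close>; their values elsewhere are irrelevant.
\<close>

record 'a cell_structure =
  cells :: "'a set"
  cell_dim :: "'a \<Rightarrow> nat"
  incidence :: "'a \<Rightarrow> 'a \<Rightarrow> real"
  weight :: "'a \<Rightarrow> real"

definition cells_of_dim :: "'a cell_structure \<Rightarrow> nat \<Rightarrow> 'a set" where
  "cells_of_dim K k = {x \<in> cells K. cell_dim K x = k}"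

definition face :: "'a cell_structure \<Rightarrow> 'a \<Rightarrow> 'a \<Rightarrow> bool" where
  "face K x z \<longleftrightarrow> x \<in> cells K \<and> z \<in> cells K \<and> incidence K x z \<noteq> 0"

locale cell_complex =
  fixes K :: "'a cell_structure"
  assumes finite_cells: "finite (cells K)"
    and weight_pos: "x \<in> cells K \<Longrightarrow> 0 < weight K x"
    and incidence_values:
      "\<lbrakk>v \<in> cells K; z \<in> cells K\<rbrakk> \<Longrightarrow> incidence K v z \<in> {-1, 0, 1}"
    and incidence_dim:
      "\<lbrakk>v \<in> cells K; z \<in> cells K; cell_dim K z \<noteq> cell_dim K v + 1\<rbrakk> \<Longrightarrow> incidence K v z = 0"
    and ex_face: "\<lbrakk>z \<in> cells K; 1 \<le> cell_dim K z\<rbrakk> \<Longrightarrow> \<exists>x. face K x z"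
    and edge_vertices:
      "x \<in> cells_of_dim K 1 \<Longrightarrow>
         (\<exists>!w. w \<in> cells_of_dim K 0 \<and> incidence K w x = 1) \<and>
         (\<exists>!w. w \<in> cells_of_dim K 0 \<and> incidence K w x = -1)"
    and diamond:
      "\<lbrakk>v \<in> cells K; z \<in> cells K; cell_dim K z = cell_dim K v + 2;
        {x. face K v x \<and> face K x z} \<noteq> {}\<rbrakk> \<Longrightarrow>
         card {x. face K v x \<and> face K x z} = 2 \<and>
         {-1, 1} \<subseteq> {incidence K v x * incidence K x z |x. x \<in> cells K}"
    and boundary_connected:
      "\<lbrakk>z \<in> cells K; 2 \<le> cell_dim K z; face K x z; face K y z\<rbrakk> \<Longrightarrow>
         \<exists>(n::nat) s. s 0 = x \<and> s n = y \<and>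
           (\<forall>i\<le>n. s i \<in> {u. face K u z} \<union> {v. \<exists>u. face K v u \<and> face K u z}) \<and>
           (\<forall>i\<in>{1..n}. incidence K (s i) (s (i - 1)) + incidence K (s (i - 1)) (s i) \<noteq> 0)"
    and boundary_determines:
      "\<lbrakk>z \<in> cells K; z' \<in> cells K; {x. face K x z} = {x. face K x z'}; 1 \<le> cell_dim K z\<rbrakk>
         \<Longrightarrow> z = z'"

definition complex_dim :: "'a cell_structure \<Rightarrow> nat" where
  "complex_dim K = Max (cell_dim K ` cells K)"

text \<open>
  \<open>K\<close> has 1-skeleton \<open>G\<close>. Both complexes have cells in the same type; when that type is infinite
  it has room for every finite complex extending \<open>G\<close>, up to relabelling the additional cells.
\<close>

definition has_one_skeleton :: "'a cell_structure \<Rightarrow> 'a cell_structure \<Rightarrow> bool" where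
  "has_one_skeleton K G \<longleftrightarrow>
     cells_of_dim K 0 = cells_of_dim G 0 \<and> cells_of_dim K 1 = cells_of_dim G 1 \<and>
     cells G = cells_of_dim K 0 \<union> cells_of_dim K 1 \<and>
     (\<forall>x\<in>cells G. \<forall>y\<in>cells G. incidence K x y = incidence G x y) \<and>
     (\<forall>x\<in>cells G. weight K x = weight G x)"

text \<open>\<open>C(X)\<close> is represented by the functions on the whole type that vanish outside \<open>X\<close>.\<close>

definition fun_space :: "'a cell_structure \<Rightarrow> ('a \<Rightarrow> real) set" where
  "fun_space K = {f. \<forall>x. x \<notin> cells K \<longrightarrow> f x = 0}"

definition scalar_prod :: "'a cell_structure \<Rightarrow> ('a \<Rightarrow> real) \<Rightarrow> ('a \<Rightarrow> real) \<Rightarrow> real" where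
  "scalar_prod K f g = (\<Sum>x\<in>cells K. f x * g x * weight K x)"

definition coboundary :: "'a cell_structure \<Rightarrow> ('a \<Rightarrow> real) \<Rightarrow> 'a \<Rightarrow> real" where
  "coboundary K f = (\<lambda>z. if z \<in> cells K then \<Sum>v\<in>cells K. f v * incidence K v z else 0)"

definition adj_coboundary :: "'a cell_structure \<Rightarrow> ('a \<Rightarrow> real) \<Rightarrow> 'a \<Rightarrow> real" where
  "adj_coboundary K g =
     (THE h. h \<in> fun_space K \<and>
        (\<forall>f\<in>fun_space K. scalar_prod K (coboundary K f) g = scalar_prod K f h))"

definition hodge_laplacian :: "'a cell_structure \<Rightarrow> ('a \<Rightarrow> real) \<Rightarrow> 'a \<Rightarrow> real" where
  "hodge_laplacian K f =
     (\<lambda>x. coboundary K (adj_coboundary K f) x + adj_coboundary K (coboundary K f) x)"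

definition edge_joins :: "'a cell_structure \<Rightarrow> 'a \<Rightarrow> 'a \<Rightarrow> 'a \<Rightarrow> bool" where
  "edge_joins K x v w \<longleftrightarrow> x \<in> cells_of_dim K 1 \<and> {u. face K u x} = {v, w}"

definition adjacent :: "'a cell_structure \<Rightarrow> 'a \<Rightarrow> 'a \<Rightarrow> bool" where
  "adjacent K v w \<longleftrightarrow> (\<exists>x. edge_joins K x v w)"

text \<open>
  \<open>\<omega>(v,w)\<close> for adjacent vertices; the edge is unique because distinct edges have distinct vertex sets.
\<close>

definition pair_length :: "'a cell_structure \<Rightarrow> ('a \<Rightarrow> real) \<Rightarrow> 'a \<Rightarrow> 'a \<Rightarrow> real" where
  "pair_length K \<omega> v w = \<omega> (THE x. edge_joins K x v w)"

definition vertex_path :: "'a cell_structure \<Rightarrow> 'a \<Rightarrow> 'a list \<Rightarrow> 'a \<Rightarrow> bool" where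
  "vertex_path K v p w \<longleftrightarrow>
     p \<noteq> [] \<and> hd p = v \<and> last p = w \<and> set p \<subseteq> cells_of_dim K 0 \<and> successively (adjacent K) p"

definition path_length :: "'a cell_structure \<Rightarrow> ('a \<Rightarrow> real) \<Rightarrow> 'a list \<Rightarrow> real" where
  "path_length K \<omega> p = (\<Sum>k\<in>{1..<length p}. pair_length K \<omega> (p ! k) (p ! (k - 1)))"

text \<open>Extended reals, so that vertices in different components have distance \<open>\<infinity>\<close>.\<close>

definition path_dist :: "'a cell_structure \<Rightarrow> ('a \<Rightarrow> real) \<Rightarrow> 'a \<Rightarrow> 'a \<Rightarrow> ereal" where
  "path_dist K \<omega> v w = (INF p\<in>{p. vertex_path K v p w}. ereal (path_length K \<omega> p))"

definition shortest_path :: "'a cell_structure \<Rightarrow> ('a \<Rightarrow> real) \<Rightarrow> 'a \<Rightarrow> 'a list \<Rightarrow> 'a \<Rightarrow> bool" where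
  "shortest_path K \<omega> v p w \<longleftrightarrow>
     vertex_path K v p w \<and> ereal (path_length K \<omega> p) = path_dist K \<omega> v w"

definition nondegenerate :: "'a cell_structure \<Rightarrow> ('a \<Rightarrow> real) \<Rightarrow> bool" where
  "nondegenerate K \<omega> \<longleftrightarrow>
     (\<forall>x v w. edge_joins K x v w \<longrightarrow> (\<forall>p. shortest_path K \<omega> v p w \<longleftrightarrow> p = [v, w]))"

definition ollivier_curvature :: "'a cell_structure \<Rightarrow> ('a \<Rightarrow> real) \<Rightarrow> 'a \<Rightarrow> real" where
  "ollivier_curvature K \<omega> x =
     Inf {coboundary K (adj_coboundary K (coboundary K f)) x |f.
            f \<in> fun_space K \<and> coboundary K f x = \<omega> x \<and>
            (\<forall>y\<in>cells K. \<bar>coboundary K f y\<bar> \<le> \<omega> y)} / \<omega> x"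

text \<open>A cell \<open>x\<close> is identified with its indicator function \<open>indicator {x}\<close>.\<close>

definition forman_curvature :: "'a cell_structure \<Rightarrow> ('a \<Rightarrow> real) \<Rightarrow> 'a \<Rightarrow> real" where
  "forman_curvature K \<omega> x =
     hodge_laplacian K (indicator {x}) x -
     (\<Sum>y\<in>cells_of_dim K 1 - {x}. \<omega> y / \<omega> x * \<bar>hodge_laplacian K (indicator {y}) x\<bar>)"

lemma coboundary_indicator:
  assumes "finite (cells K)" "v \<in> cells K" "z \<in> cells K"
  shows "coboundary K (indicator {v}) z = incidence K v z"
proof -
  have "(\<Sum>u\<in>cells K. indicator {v} u * incidence K u z) =
      (\<Sum>u\<in>cells K. if u = v then incidence K u z else 0)"
    by (rule sum.cong) auto
  then show ?thesis using assms by (simp add: coboundary_def)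
qed

lemma scalar_prod_indicator:
  assumes "finite (cells K)" "x \<in> cells K"
  shows "scalar_prod K (indicator {x}) h = h x * weight K x"
proof -
  have "(\<Sum>u\<in>cells K. indicator {x} u * h u * weight K u) =
      (\<Sum>u\<in>cells K. if u = x then h u * weight K u else 0)"
    by (rule sum.cong) auto
  then show ?thesis using assms by (simp add: scalar_prod_def)
qed

context cell_complex
begin

lemma adj_coboundary_eq:
  "adj_coboundary K g =
     (\<lambda>x. if x \<in> cells K
          then (\<Sum>z\<in>cells K. incidence K x z * g z * weight K z) / weight K x else 0)"
  (is "_ = ?h")
  unfolding adj_coboundary_def
proof (rule the_equality)
  have "scalar_prod K (coboundary K f) g = scalar_prod K f ?h" for f
  proof -
    have "scalar_prod K (coboundary K f) g =
        (\<Sum>z\<in>cells K. \<Sum>x\<in>cells K. f x * incidence K x z * g z * weight K z)"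
      by (simp add: scalar_prod_def coboundary_def sum_distrib_right)
    also have "\<dots> = (\<Sum>x\<in>cells K. \<Sum>z\<in>cells K. f x * incidence K x z * g z * weight K z)"
      by (rule sum.swap)
    also have "\<dots> = scalar_prod K f ?h"
      unfolding scalar_prod_def
    proof (rule sum.cong[OF refl])
      fix x assume x: "x \<in> cells K"
      then show "(\<Sum>z\<in>cells K. f x * incidence K x z * g z * weight K z) = f x * ?h x * weight K x"
        using weight_pos[OF x] by (simp add: sum_distrib_left mult.assoc)
    qed
    finally show ?thesis .
  qed
  then show "?h \<in> fun_space K \<and>
      (\<forall>f\<in>fun_space K. scalar_prod K (coboundary K f) g = scalar_prod K f ?h)"
    by (simp add: fun_space_def)
  then have adj: "\<forall>f\<in>fun_space K. scalar_prod K (coboundary K f) g = scalar_prod K f ?h"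
    by (rule conjunct2)
  fix h
  assume h: "h \<in> fun_space K \<and>
      (\<forall>f\<in>fun_space K. scalar_prod K (coboundary K f) g = scalar_prod K f h)"
  show "h = ?h"
  proof
    fix x
    show "h x = ?h x"
    proof (cases "x \<in> cells K")
      case True
      then have ind: "indicator {x} \<in> fun_space K"
        by (auto simp: fun_space_def indicator_def)
      have "scalar_prod K (indicator {x}) h = scalar_prod K (indicator {x}) ?h"
        by (rule trans[OF sym[OF h[THEN conjunct2, rule_format, OF ind]] adj[rule_format, OF ind]])
      then have "h x * weight K x = ?h x * weight K x"
        by (simp only: scalar_prod_indicator[OF finite_cells True])
      with weight_pos[OF True] show ?thesis by simp
    next
      case False
      with h show ?thesis by (simp add: fun_space_def)
    qed
  qed
qed

end

end

theory Submission
  imports Defs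
begin

text \<open>
  Write \<open>v\<close>, \<open>w\<close> for the ends of \<open>x\<close>. For a complex \<open>K\<close> over \<open>G\<close>, the row of the Hodge Laplacian at \<open>x\<close> is
  \<open>lower x + upper x\<close>, where \<open>lower x\<close> only depends on \<open>G\<close> and \<open>upper x\<close> annihilates coboundaries of
  vertex functions; so every \<open>f\<close> competing in the Ollivier infimum gives an upper bound for the
  Forman curvature. For the converse, this is linear programming duality: a 2-cell attached along
  a cycle through \<open>x\<close> with weight \<open>m x * t\<close> adds \<open>t\<close> times that cycle to \<open>upper x\<close>. The dual linear
  program over nonnegative combinations of simple cycles through \<open>x\<close> has value at least the
  infimum. Otherwise Farkas' lemma yields an edge function \<open>g\<close>, not necessarily a coboundary,
  which is bounded by \<open>\<omega>\<close>, has a smaller objective value, and decreases by at least \<open>\<omega> x\<close> along every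
  simple path from \<open>w\<close> to \<open>v\<close>. As \<open>lower x\<close> only sees the edges at \<open>v\<close> and \<open>w\<close>, it suffices to find a
  vertex function that agrees with \<open>g\<close> or does better on those edges; a McShane type extension
  does, and nondegeneracy makes it Lipschitz.
\<close>

section \<open>Systems of linear inequalities\<close>

text \<open>Elimination of a variable needs a value between all its lower and all its upper
  bounds.\<close>

lemma real_between_finite_sets:
  fixes L U :: "real set"
  assumes "finite L" "finite U" "\<And>l u. l \<in> L \<Longrightarrow> u \<in> U \<Longrightarrow> l \<le> u"
  obtains x where "\<And>l. l \<in> L \<Longrightarrow> l \<le> x" "\<And>u. u \<in> U \<Longrightarrow> x \<le> u"
proof (cases "L = {}")
  case False
  then show ?thesis
    using assms by (intro that[of "Max L"]) auto
next
  case True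
  then show ?thesis
    using assms by (cases "U = {}") (auto intro: that[of "Min U"] that[of 0])
qed

text \<open>
  The predicate \<open>P\<close> stands for any property shared by all nonnegative combinations of the given
  inequalities. The proof is Fourier-Motzkin elimination of the variable \<open>k\<close>.
\<close>

lemma farkas_cone:
  fixes S :: "(('j \<Rightarrow> real) \<times> real) set"
  assumes "finite J" "finite S" "\<And>a b. (a, b) \<in> S \<Longrightarrow> P a b"
    and "\<And>a b a' b'. P a b \<Longrightarrow> P a' b' \<Longrightarrow> P (\<lambda>j. a j + a' j) (b + b')"
    and "\<And>a b c. P a b \<Longrightarrow> 0 < c \<Longrightarrow> P (\<lambda>j. c * a j) (c * b)"
  shows "(\<exists>x. \<forall>(a, b)\<in>S. (\<Sum>j\<in>J. a j * x j) \<le> b) \<or>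
    (\<exists>a b. P a b \<and> (\<forall>j\<in>J. a j = 0) \<and> b < 0)"
  using assms
proof (induction J arbitrary: S P rule: finite_induct)
  case empty
  \<comment> \<open>Without variables a row fails only if \<open>b < 0\<close>, and then it is its
    own certificate.\<close>
  then show ?case by (force simp: not_less[symmetric])
next
  case (insert k J)
  define S0 where "S0 = {(a, b) \<in> S. a k = 0}"
  define SU where "SU = {(a, b) \<in> S. a k > 0}"
  define SL where "SL = {(a, b) \<in> S. a k < 0}"
  \<comment> \<open>A positive combination of an upper and a lower bound on the variable
    \<open>k\<close>, in which \<open>k\<close> cancels.\<close>
  define comb where "comb = (\<lambda>((a :: 'j \<Rightarrow> real, b :: real), (a', b')).
    (\<lambda>j. - a' k * a j + a k * a' j, - a' k * b + a k * b'))"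
  have fin: "finite S0" "finite SU" "finite SL"
    unfolding S0_def SU_def SL_def by (rule finite_subset[OF _ \<open>finite S\<close>]; auto)+
  \<comment> \<open>The added clause makes a certificate from the induction hypothesis vanish at
    \<open>k\<close> too.\<close>
  let ?P' = "\<lambda>a b. P a b \<and> a k = 0"
  have "(\<exists>x. \<forall>(a, b)\<in>S0 \<union> comb ` (SU \<times> SL). (\<Sum>j\<in>J. a j * x j) \<le> b) \<or>
    (\<exists>a b. ?P' a b \<and> (\<forall>j\<in>J. a j = 0) \<and> b < 0)"
  proof (rule insert.IH)
    show "finite (S0 \<union> comb ` (SU \<times> SL))"
      using fin by auto
    fix a b assume "(a, b) \<in> S0 \<union> comb ` (SU \<times> SL)"
    then consider "(a, b) \<in> S" "a k = 0"
      | a1 b1 a2 b2 where "(a1, b1) \<in> S" "a1 k > 0" "(a2, b2) \<in> S" "a2 k < 0"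
          "a = (\<lambda>j. - a2 k * a1 j + a1 k * a2 j)" "b = - a2 k * b1 + a1 k * b2"
      unfolding S0_def SU_def SL_def comb_def by force
    then show "?P' a b"
    proof cases
      case 2
      have "P (\<lambda>j. - a2 k * a1 j + a1 k * a2 j) (- a2 k * b1 + a1 k * b2)"
        by (intro insert.prems(3) insert.prems(4)) (use 2 insert.prems(2) in auto)
      then show ?thesis using 2 by simp
    qed (use insert.prems(2) in auto)
  qed (use insert.prems(3,4) in auto)
  then show ?case
  proof
    assume "\<exists>x. \<forall>(a, b)\<in>S0 \<union> comb ` (SU \<times> SL). (\<Sum>j\<in>J. a j * x j) \<le> b"
    then obtain x where x: "\<And>a b. (a, b) \<in> S0 \<union> comb ` (SU \<times> SL) \<Longrightarrow> (\<Sum>j\<in>J. a j * x j) \<le> b"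
      by blast
    \<comment> \<open>With the other variables fixed to \<open>x\<close>, the row bounds variable
      \<open>k\<close> by this quotient: from above for \<open>SU\<close>, from below for
      \<open>SL\<close>.\<close>
    define r where "r = (\<lambda>(a :: 'j \<Rightarrow> real, b). (b - (\<Sum>j\<in>J. a j * x j)) / a k)"
    have "l \<le> u" if lu: "l \<in> r ` SL" "u \<in> r ` SU" for l u
    proof -
      obtain s s' where "s \<in> SU" "s' \<in> SL" "u = r s" "l = r s'"
        using lu by blast
      then obtain a b a' b' where ab: "(a, b) \<in> SU" "(a', b') \<in> SL" "u = r (a, b)" "l = r (a', b')"
        by (cases s, cases s') simp
      have pos: "a k > 0" "a' k < 0"
        using ab by (auto simp: SU_def SL_def)
      have "(\<Sum>j\<in>J. (- a' k * a j + a k * a' j) * x j) \<le> - a' k * b + a k * b'"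
        by (rule x, rule UnI2, rule image_eqI[of _ _ "((a, b), (a', b'))"]) (use ab in \<open>simp_all add: comb_def\<close>)
      also have "(\<Sum>j\<in>J. (- a' k * a j + a k * a' j) * x j) =
          - a' k * (\<Sum>j\<in>J. a j * x j) + a k * (\<Sum>j\<in>J. a' j * x j)"
        unfolding sum_distrib_left sum.distrib[symmetric] by (intro sum.cong refl) algebra
      finally have "- a' k * (\<Sum>j\<in>J. a j * x j) + a k * (\<Sum>j\<in>J. a' j * x j) \<le> - a' k * b + a k * b'" .
      then show ?thesis
        unfolding ab(3,4) r_def using pos by (simp add: field_simps)
    qed
    then obtain y where y: "\<And>l. l \<in> r ` SL \<Longrightarrow> l \<le> y" "\<And>u. u \<in> r ` SU \<Longrightarrow> y \<le> u"
      using real_between_finite_sets[of "r ` SL" "r ` SU"] fin by blast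
    have "(\<Sum>j\<in>insert k J. a j * (x(k := y)) j) \<le> b" if "(a, b) \<in> S" for a b
    proof -
      have "(\<Sum>j\<in>J. a j * (x(k := y)) j) = (\<Sum>j\<in>J. a j * x j)"
        using insert.hyps by (intro sum.cong) auto
      then have eq: "(\<Sum>j\<in>insert k J. a j * (x(k := y)) j) = a k * y + (\<Sum>j\<in>J. a j * x j)"
        using insert.hyps by simp
      consider "a k = 0" | "a k > 0" | "a k < 0" by linarith
      then show ?thesis
      proof cases
        case 1
        then show ?thesis using x[of a b] that eq by (simp add: S0_def)
      next
        case 2
        then have "y \<le> r (a, b)" using y(2) that by (simp add: SU_def)
        then show ?thesis using 2 eq by (simp add: r_def field_simps)
      next
        case 3
        then have "r (a, b) \<le> y" using y(1) that by (simp add: SL_def)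
        then show ?thesis using 3 eq by (simp add: r_def field_simps)
      qed
    qed
    then show ?thesis by blast
  qed blast
qed

section \<open>Walks as lists of vertices\<close>

fun walk_sum :: "('a \<Rightarrow> 'a \<Rightarrow> real) \<Rightarrow> 'a list \<Rightarrow> real" where
  "walk_sum \<gamma> (a # b # p) = \<gamma> a b + walk_sum \<gamma> (b # p)"
| "walk_sum \<gamma> _ = 0"

text \<open>Steps are directed, as signs depend on the direction of travel. The set forgets
  multiplicities, so sums over it are formed for distinct lists only.\<close>

fun steps :: "'a list \<Rightarrow> ('a \<times> 'a) set" where
  "steps (a # b # p) = insert (a, b) (steps (b # p))"
| "steps _ = {}"

lemma walk_sum_append: "walk_sum \<gamma> (p @ a # q) = walk_sum \<gamma> (p @ [a]) + walk_sum \<gamma> (a # q)"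
  by (induction \<gamma> p rule: walk_sum.induct) (auto split: list.splits simp: neq_Nil_conv)

lemma walk_sum_snoc: "p \<noteq> [] \<Longrightarrow> walk_sum \<gamma> (p @ [a]) = walk_sum \<gamma> p + \<gamma> (last p) a"
  by (induction \<gamma> p rule: walk_sum.induct) auto

lemma walk_sum_mono:
  "(\<And>a b. (a, b) \<in> steps p \<Longrightarrow> \<gamma> a b \<le> \<gamma>' a b) \<Longrightarrow> walk_sum \<gamma> p \<le> walk_sum \<gamma>' p"
  by (induction \<gamma> p rule: walk_sum.induct) (auto intro!: add_mono)

lemma walk_sum_cong:
  "(\<And>a b. (a, b) \<in> steps p \<Longrightarrow> \<gamma> a b = \<gamma>' a b) \<Longrightarrow> walk_sum \<gamma> p = walk_sum \<gamma>' p"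
  by (induction \<gamma> p rule: walk_sum.induct) auto

lemma walk_sum_uminus: "walk_sum (\<lambda>a b. - \<gamma> a b) p = - walk_sum \<gamma> p"
  by (induction \<gamma> p rule: walk_sum.induct) auto

lemma walk_sum_eq_nth: "walk_sum \<gamma> p = (\<Sum>k\<in>{1..<length p}. \<gamma> (p ! (k - 1)) (p ! k))"
proof (induction \<gamma> p rule: walk_sum.induct)
  case (1 \<gamma> a b p)
  have "(\<Sum>k\<in>{1..<length (a # b # p)}. \<gamma> ((a # b # p) ! (k - 1)) ((a # b # p) ! k)) =
      (\<Sum>k\<in>{0..<length (b # p)}. \<gamma> ((a # b # p) ! k) ((b # p) ! k))"
    by (rule sum.reindex_bij_witness[of _ Suc "\<lambda>k. k - 1"]) (auto simp: nth_Cons')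
  also have "\<dots> = \<gamma> a b + (\<Sum>k\<in>{1..<length (b # p)}. \<gamma> ((a # b # p) ! k) ((b # p) ! k))"
    by (simp add: sum.atLeast_Suc_lessThan)
  also have "(\<Sum>k\<in>{1..<length (b # p)}. \<gamma> ((a # b # p) ! k) ((b # p) ! k)) =
      (\<Sum>k\<in>{1..<length (b # p)}. \<gamma> ((b # p) ! (k - 1)) ((b # p) ! k))"
    by (intro sum.cong) auto
  finally show ?case using 1 by simp
qed auto

lemma finite_steps [simp]: "finite (steps p)"
  by (induction p rule: steps.induct) auto

lemma steps_subset: "steps p \<subseteq> set p \<times> set (tl p)"
  by (induction p rule: steps.induct) auto

lemma steps_snd_not_hd: "distinct p \<Longrightarrow> (a, b) \<in> steps p \<Longrightarrow> b \<noteq> hd p"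
  using steps_subset[of p] by (cases p) auto

lemma walk_sum_eq_sum_steps: "distinct p \<Longrightarrow> walk_sum \<gamma> p = (\<Sum>(a, b)\<in>steps p. \<gamma> a b)"
proof (induction \<gamma> p rule: walk_sum.induct)
  case (1 \<gamma> a b p)
  moreover have "(a, b) \<notin> steps (b # p)"
    using 1(2) steps_subset[of "b # p"] by auto
  ultimately show ?case by simp
qed auto

lemma successively_steps: "successively R p \<longleftrightarrow> (\<forall>(a, b)\<in>steps p. R a b)"
  by (induction p rule: steps.induct) auto

lemma steps_succ_ex: "u \<in> set p \<Longrightarrow> u \<noteq> last p \<Longrightarrow> \<exists>b. (u, b) \<in> steps p"
  by (induction p rule: steps.induct) (auto split: if_splits)

lemma steps_pred_ex: "u \<in> set p \<Longrightarrow> u \<noteq> hd p \<Longrightarrow> \<exists>a. (a, u) \<in> steps p"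
proof (induction p rule: steps.induct)
  case (1 a b p)
  then show ?case by (cases "u = b") auto
qed auto

lemma steps_fst_not_last: "distinct p \<Longrightarrow> (a, b) \<in> steps p \<Longrightarrow> a \<noteq> last p"
  by (induction p rule: steps.induct) auto

lemma steps_succ_unique: "distinct p \<Longrightarrow> (a, b) \<in> steps p \<Longrightarrow> (a, c) \<in> steps p \<Longrightarrow> b = c"
proof (induction p rule: steps.induct)
  case (1 a' b' p)
  then show ?case using steps_subset[of "b' # p"] by auto
qed auto

lemma steps_pred_unique: "distinct p \<Longrightarrow> (a, c) \<in> steps p \<Longrightarrow> (b, c) \<in> steps p \<Longrightarrow> a = b"
proof (induction p rule: steps.induct)
  case (1 a' b' p)
  then show ?case using steps_snd_not_hd[of "b' # p"] by auto
qed auto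

lemma steps_asym: "distinct p \<Longrightarrow> (a, b) \<in> steps p \<Longrightarrow> (b, a) \<notin> steps p"
proof (induction p rule: steps.induct)
  case (1 a' b' p)
  then show ?case using steps_subset[of "b' # p"] by auto
qed auto

lemma steps_reachable: "u \<in> set p \<Longrightarrow> (hd p, u) \<in> (steps p)\<^sup>*"
proof (induction p rule: steps.induct)
  case (1 a b p)
  show ?case
  proof (cases "u = a")
    case False
    then have "(b, u) \<in> (steps (b # p))\<^sup>*" using 1 by simp
    then have "(b, u) \<in> (steps (a # b # p))\<^sup>*" by (rule rtrancl_mono[THEN subsetD, rotated]) auto
    then show ?thesis by (auto intro: converse_rtrancl_into_rtrancl)
  qed simp
qed auto

text \<open>The first vertex of a distinct list lies on its first step only, so the undirected edges
  reveal that step and induction removes it. This will tell apart the 2-cells of different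
  paths.\<close>

lemma distinct_path_eqI:
  "\<lbrakk>distinct p; distinct q; p \<noteq> []; q \<noteq> []; hd p = hd q; last p = last q;
    (\<lambda>(a, b). {a, b}) ` steps p = (\<lambda>(a, b). {a, b}) ` steps q\<rbrakk> \<Longrightarrow> p = q"
proof (induction p arbitrary: q rule: steps.induct)
  case (1 a b p)
  have fresh: "{a, c} \<notin> (\<lambda>(a, b). {a, b}) ` steps r" if "a \<notin> set r" for r c
    using that steps_subset[of r] by (cases r) (auto simp: doubleton_eq_iff)
  obtain b' q' where q: "q = a # b' # q'"
  proof (cases q rule: steps.cases)
    case (1 x y z)
    then show ?thesis using "1.prems" that by auto
  next
    case ("2_2" x)
    then show ?thesis using "1.prems" by auto
  qed (use "1.prems" in auto)
  have na: "a \<notin> set (b # p)" "a \<notin> set (b' # q')"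
    using "1.prems" q by auto
  have U: "insert {a, b} ((\<lambda>(a, b). {a, b}) ` steps (b # p)) =
      insert {a, b'} ((\<lambda>(a, b). {a, b}) ` steps (b' # q'))"
    using "1.prems"(7) q by simp
  then have "{a, b} \<in> insert {a, b'} ((\<lambda>(a, b). {a, b}) ` steps (b' # q'))"
    by (metis insertI1)
  then have "{a, b} = {a, b'}"
    using fresh[OF na(2), of b] by (meson insertE)
  then have b: "b = b'" by (auto simp: doubleton_eq_iff)
  have "(\<lambda>(a, b). {a, b}) ` steps (b # p) = (\<lambda>(a, b). {a, b}) ` steps (b # q')"
    by (rule insert_ident[OF fresh[OF na(1)] fresh[OF na(2)], folded b, THEN iffD1, OF U[folded b]])
  then show ?case
    using "1.IH"[of "b' # q'"] "1.prems" q b by simp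
next
  case ("2_2" a)
  then show ?case by (cases q rule: steps.cases) auto
qed simp

section \<open>Graphs\<close>

locale graph_complex = cell_complex G for G :: "'a cell_structure" +
  assumes one_dim: "cells G = cells_of_dim G 0 \<union> cells_of_dim G 1"
begin

abbreviation "V \<equiv> cells_of_dim G 0"
definition "E = cells_of_dim G 1"
abbreviation "inc \<equiv> incidence G"

definition tail :: "'a \<Rightarrow> 'a" where "tail e = (THE w. w \<in> V \<and> inc w e = -1)"
definition head :: "'a \<Rightarrow> 'a" where "head e = (THE w. w \<in> V \<and> inc w e = 1)"

lemma cells_eq: "cells G = V \<union> E"
  using one_dim by (simp add: E_def)

lemma finite_VE [simp]: "finite V" "finite E"
  using finite_cells cells_eq by auto

lemma E_dim: "e \<in> E \<Longrightarrow> e \<in> cells G \<and> cell_dim G e = 1"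
  and V_dim: "u \<in> V \<Longrightarrow> u \<in> cells G \<and> cell_dim G u = 0"
  by (auto simp: cells_of_dim_def E_def)

lemma tail: "e \<in> E \<Longrightarrow> tail e \<in> V" "e \<in> E \<Longrightarrow> inc (tail e) e = -1"
  using edge_vertices[of e] theI'[of "\<lambda>w. w \<in> V \<and> inc w e = -1"] by (auto simp: tail_def E_def)

lemma head: "e \<in> E \<Longrightarrow> head e \<in> V" "e \<in> E \<Longrightarrow> inc (head e) e = 1"
  using edge_vertices[of e] theI'[of "\<lambda>w. w \<in> V \<and> inc w e = 1"] by (auto simp: head_def E_def)

lemma tail_neq_head: "e \<in> E \<Longrightarrow> tail e \<noteq> head e"
  using tail(2)[of e] head(2)[of e] by auto

text \<open>Uniqueness in \<open>edge_vertices\<close> excludes the values 1 and -1 at all other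
  vertices.\<close>

lemma inc_eq:
  assumes u: "u \<in> V" and e: "e \<in> E"
  shows "inc u e = of_bool (u = head e) - of_bool (u = tail e)"
proof -
  note ends = tail[OF e] head[OF e] tail_neq_head[OF e]
  have "inc u e \<in> {-1, 0, 1}"
    using u e V_dim E_dim by (intro incidence_values) auto
  moreover have "inc u e \<noteq> -1" if "u \<noteq> tail e"
    using edge_vertices[of e, folded E_def, OF e] u ends that by metis
  moreover have "inc u e \<noteq> 1" if "u \<noteq> head e"
    using edge_vertices[of e, folded E_def, OF e] u ends that by metis
  ultimately show ?thesis
    using ends by (cases "u = head e"; cases "u = tail e") simp_all
qed

lemma inc_eq_0: "u \<in> cells G \<Longrightarrow> e \<in> cells G \<Longrightarrow> \<not> (u \<in> V \<and> e \<in> E) \<Longrightarrow> inc u e = 0"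
  using incidence_dim[of u e] cells_eq V_dim[of u] V_dim[of e] E_dim[of u] E_dim[of e] by auto

lemma face_edge: "e \<in> E \<Longrightarrow> {u. face G u e} = {tail e, head e}"
  using inc_eq_0[of _ e] inc_eq[of _ e] tail[of e] head[of e] cells_eq
  by (fastforce simp: face_def of_bool_def split: if_splits)

text \<open>\<open>boundary_determines\<close> excludes parallel edges, so an edge can be addressed
  by its ends.\<close>

lemma edge_unique:
  assumes "e \<in> E" "e' \<in> E" "{tail e, head e} = {tail e', head e'}"
  shows "e = e'"
  using boundary_determines[of e e'] face_edge[of e] face_edge[of e'] assms E_dim by simp

lemma edge_joins_iff: "edge_joins G e a b \<longleftrightarrow> e \<in> E \<and> {tail e, head e} = {a, b}"
  using face_edge by (auto simp: edge_joins_def E_def)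

lemma adjacent_iff: "adjacent G a b \<longleftrightarrow> (\<exists>e\<in>E. {tail e, head e} = {a, b})"
  by (auto simp: adjacent_def edge_joins_iff)

lemma adjacent_sym: "adjacent G a b \<Longrightarrow> adjacent G b a"
  by (simp add: adjacent_iff insert_commute)

lemma adjacent_V: "adjacent G a b \<Longrightarrow> a \<in> V \<and> b \<in> V \<and> a \<noteq> b"
  unfolding adjacent_iff using tail(1) head(1) tail_neq_head by (metis doubleton_eq_iff)

lemma adjacent_ends: "e \<in> E \<Longrightarrow> adjacent G (tail e) (head e)" "e \<in> E \<Longrightarrow> adjacent G (head e) (tail e)"
  by (auto simp: adjacent_iff)

lemma pair_length_eq: "e \<in> E \<Longrightarrow> {tail e, head e} = {a, b} \<Longrightarrow> pair_length G \<omega> a b = \<omega> e"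
  unfolding pair_length_def edge_joins_iff using edge_unique by (metis (mono_tags, lifting) the_equality)

lemma pair_length_sym: "pair_length G \<omega> a b = pair_length G \<omega> b a"
  unfolding pair_length_def edge_joins_iff by (simp add: insert_commute)

lemma path_length_eq: "path_length G \<omega> p = walk_sum (pair_length G \<omega>) p"
  unfolding path_length_def walk_sum_eq_nth by (intro sum.cong refl pair_length_sym)

lemma vertex_path_sub:
  "vertex_path G a (p @ b # q) c \<Longrightarrow> vertex_path G a (p @ [b]) b"
  "vertex_path G a (p @ b # q) c \<Longrightarrow> vertex_path G b (b # q) c"
  by (auto simp: vertex_path_def successively_append_iff hd_append split: if_splits)

lemma vertex_path_snoc:
  "vertex_path G a p b \<Longrightarrow> adjacent G b c \<Longrightarrow> vertex_path G a (p @ [c]) c"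
  using adjacent_V[of b c] by (auto simp: vertex_path_def successively_append_iff)

lemma steps_adjacent: "vertex_path G a p b \<Longrightarrow> (c, d) \<in> steps p \<Longrightarrow> adjacent G c d"
  by (auto simp: vertex_path_def successively_steps)

text \<open>Finiteness is the point: the potential becomes a maximum and the linear program has
  finitely many variables.\<close>

definition simple_paths :: "'a \<Rightarrow> 'a \<Rightarrow> 'a list set" where
  "simple_paths a b = {p. vertex_path G a p b \<and> distinct p}"

lemma finite_simple_paths [simp]: "finite (simple_paths a b)"
  by (rule finite_subset[OF _ finite_subset_distinct[OF finite_VE(1)]])
    (auto simp: simple_paths_def vertex_path_def)

lemma simple_paths_refl: "a \<in> V \<Longrightarrow> simple_paths a a = {[a]}"
proof (intro equalityI subsetI)
  fix p assume "p \<in> simple_paths a a"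
  then show "p \<in> {[a]}"
    by (cases p) (auto simp: simple_paths_def vertex_path_def split: if_splits)
qed (auto simp: simple_paths_def vertex_path_def)

lemma simple_paths_edge: "adjacent G a b \<Longrightarrow> [a, b] \<in> simple_paths a b"
  using adjacent_V[of a b] by (auto simp: simple_paths_def vertex_path_def)

end

section \<open>Extending increments to a potential\<close>

locale weighted_graph_complex = graph_complex +
  fixes \<omega> :: "'a \<Rightarrow> real"
  assumes \<omega>_pos: "y \<in> cells G \<Longrightarrow> 0 < \<omega> y"
    and nondeg: "nondegenerate G \<omega>"
begin

abbreviation "pl \<equiv> pair_length G \<omega>"

lemma pl_pos: "adjacent G a b \<Longrightarrow> 0 < pl a b"
  using pair_length_eq \<omega>_pos E_dim by (metis adjacent_iff)

lemma walk_sum_pl_nonneg: "vertex_path G a p b \<Longrightarrow> 0 \<le> walk_sum pl p"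
  using walk_sum_mono[of p "\<lambda>_ _. 0" pl] steps_adjacent[of a p b] pl_pos
  by (fastforce simp: walk_sum_eq_nth)

text \<open>By nondegeneracy the edge attains the path distance of its ends, a lower bound for every
  path length.\<close>

lemma pl_le_walk_sum:
  assumes "adjacent G a b" "vertex_path G a p b"
  shows "pl a b \<le> walk_sum pl p"
proof -
  obtain e where "edge_joins G e a b"
    using assms(1) by (auto simp: adjacent_def)
  then have "shortest_path G \<omega> a [a, b] b"
    using nondeg by (auto simp: nondegenerate_def)
  then have "ereal (path_length G \<omega> [a, b]) = path_dist G \<omega> a b"
    by (simp add: shortest_path_def)
  also have "\<dots> \<le> ereal (path_length G \<omega> p)"
    unfolding path_dist_def using assms(2) by (intro INF_lower) simp
  finally show ?thesis by (simp add: path_length_eq)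
qed

context
  fixes v w :: 'a and \<gamma> :: "'a \<Rightarrow> 'a \<Rightarrow> real"
  assumes vw: "adjacent G v w"
    and \<gamma>_le: "\<And>a b. adjacent G a b \<Longrightarrow> \<bar>\<gamma> a b\<bar> \<le> pl a b"
    and \<gamma>_path: "\<And>p. p \<in> simple_paths w v \<Longrightarrow> walk_sum \<gamma> p \<le> - pl v w"
begin

text \<open>
  Only the step out of \<open>w\<close> is charged by \<open>\<gamma>\<close>; charging the smallest possible increment \<open>- pl\<close> to
  every other step makes the resulting potential both Lipschitz and as small as possible at the
  neighbours of \<open>v\<close>.
\<close>

definition \<gamma>' where "\<gamma>' a b = (if a = w then \<gamma> a b else - pl a b)"

lemma \<gamma>'_bounds: "adjacent G a b \<Longrightarrow> - pl a b \<le> \<gamma>' a b \<and> \<gamma>' a b \<le> \<gamma> a b"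
  using \<gamma>_le[of a b] by (auto simp: \<gamma>'_def)

lemma walk_sum_\<gamma>'_le: "vertex_path G a p b \<Longrightarrow> walk_sum \<gamma>' p \<le> walk_sum \<gamma> p"
  using \<gamma>'_bounds steps_adjacent by (intro walk_sum_mono) blast

lemma walk_sum_\<gamma>': "w \<notin> set p \<Longrightarrow> walk_sum \<gamma>' p = - walk_sum pl p"
  unfolding walk_sum_uminus[symmetric] using steps_subset[of p]
  by (intro walk_sum_cong) (auto simp: \<gamma>'_def)

text \<open>Append \<open>z'\<close>, or cut \<open>p\<close> where it has already visited
  \<open>z'\<close>; the piece cut off must be charged at most \<open>pl z z'\<close>. This estimate
  makes the potential Lipschitz.\<close>

lemma extend_simple_path:
  assumes p: "p \<in> simple_paths w z" and adj: "adjacent G z z'"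
  obtains p' where "p' \<in> simple_paths w z'" "walk_sum \<gamma>' p - pl z z' \<le> walk_sum \<gamma>' p'"
proof (cases "z' \<in> set p")
  case False
  have "walk_sum \<gamma>' (p @ [z']) = walk_sum \<gamma>' p + \<gamma>' z z'"
    using p by (subst walk_sum_snoc) (auto simp: simple_paths_def vertex_path_def)
  then show ?thesis
    using False p vertex_path_snoc[OF _ adj] \<gamma>'_bounds[OF adj]
    by (intro that[of "p @ [z']"]) (auto simp: simple_paths_def)
next
  case True
  then obtain p1 p2 where eq: "p = p1 @ z' # p2" by (auto simp: in_set_conv_decomp)
  have path: "vertex_path G w p z" and dist: "distinct p"
    using p by (auto simp: simple_paths_def)
  have p': "p1 @ [z'] \<in> simple_paths w z'"
    using vertex_path_sub(1)[of w p1 z' p2 z] path dist eq by (auto simp: simple_paths_def)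
  \<comment> \<open>A piece avoiding \<open>w\<close> is charged minus its length. A piece starting
    at \<open>w\<close> has a first step \<open>w\<close>, \<open>u\<close> charged at most
    \<open>pl w u\<close>, and nondegeneracy compares this edge with the way from \<open>u\<close>
    along the piece to \<open>z\<close> and back to \<open>w\<close>.\<close>
  have "walk_sum \<gamma>' (z' # p2) \<le> pl z z'"
  proof (cases "z' = w")
    case False
    then have "w \<notin> set (z' # p2)"
      using path dist eq by (cases p1) (auto simp: vertex_path_def)
    then have "walk_sum \<gamma>' (z' # p2) = - walk_sum pl (z' # p2)"
      by (rule walk_sum_\<gamma>')
    also have "\<dots> \<le> 0"
      using walk_sum_pl_nonneg[OF vertex_path_sub(2)] path eq by auto
    finally show ?thesis using pl_pos[OF adj] by simp
  next
    case True
    then have p1: "p1 = []"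
      using path dist eq by (cases p1) (auto simp: vertex_path_def)
    have "p2 \<noteq> []"
      using path eq True p1 adjacent_V[OF adj] by (auto simp: vertex_path_def)
    then obtain u r where p2: "p2 = u # r" by (cases p2) auto
    have w: "w \<notin> set (u # r)"
      using dist eq True p2 by auto
    have ur: "vertex_path G u (u # r) z"
      using vertex_path_sub(2)[of w "[w]" u r z] path eq p1 p2 True by simp
    have wu: "adjacent G w u"
      using path eq p1 p2 True by (auto simp: vertex_path_def)
    have "vertex_path G u ((u # r) @ [w]) w"
      using vertex_path_snoc[OF ur] adj True by simp
    then have "pl u w \<le> walk_sum pl ((u # r) @ [w])"
      using pl_le_walk_sum adjacent_sym wu by blast
    also have "\<dots> = walk_sum pl (u # r) + pl z w"
      using ur by (subst walk_sum_snoc) (auto simp: vertex_path_def)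
    finally show ?thesis
      using True p2 walk_sum_\<gamma>'[OF w] \<gamma>_le[OF wu] pair_length_sym[of \<omega> u w] by (simp add: \<gamma>'_def)
  qed
  then show ?thesis
    using p' by (intro that[of "p1 @ [z']"]) (auto simp: eq walk_sum_append[of _ p1 z' p2])
qed

text \<open>The McShane extension, with steps charged by \<open>\<gamma>'\<close>. The shift gives
  \<open>v\<close> the value 0 and \<open>w\<close> the value \<open>pl v w\<close>; the default 0
  is harmless because no edge joins vertices that \<open>w\<close> reaches to others.\<close>

definition pot :: "'a \<Rightarrow> real" where
  "pot z = (if simple_paths w z = {} then 0
            else pl v w + Max (walk_sum \<gamma>' ` simple_paths w z))"

lemma pot_ge: "p \<in> simple_paths w z \<Longrightarrow> pl v w + walk_sum \<gamma>' p \<le> pot z"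
  by (auto simp: pot_def)

lemma pot_attained:
  assumes "simple_paths w z \<noteq> {}"
  obtains p where "p \<in> simple_paths w z" "pot z = pl v w + walk_sum \<gamma>' p"
proof -
  have "Max (walk_sum \<gamma>' ` simple_paths w z) \<in> walk_sum \<gamma>' ` simple_paths w z"
    using assms by (intro Max_in) auto
  then obtain p where "p \<in> simple_paths w z" "Max (walk_sum \<gamma>' ` simple_paths w z) = walk_sum \<gamma>' p"
    by blast
  then show ?thesis using assms by (intro that[of p]) (simp_all add: pot_def)
qed

lemma pot_lipschitz:
  assumes "adjacent G a b"
  shows "pot a - pot b \<le> pl a b"
proof (cases "simple_paths w a = {}")
  case True
  then have "simple_paths w b = {}"
    using extend_simple_path[OF _ adjacent_sym[OF assms]] by blast
  then show ?thesis using True pl_pos[OF assms] by (simp add: pot_def)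
next
  case False
  then obtain p where p: "p \<in> simple_paths w a" "pot a = pl v w + walk_sum \<gamma>' p"
    by (rule pot_attained)
  then obtain p' where "p' \<in> simple_paths w b" "walk_sum \<gamma>' p - pl a b \<le> walk_sum \<gamma>' p'"
    using extend_simple_path[OF _ assms] by blast
  then show ?thesis using pot_ge[of p' b] p by simp
qed

lemma pot_w: "pot w = pl v w"
  using adjacent_V[OF vw] by (simp add: pot_def simple_paths_refl)

lemma walk_sum_\<gamma>'_v: "p \<in> simple_paths w v \<Longrightarrow> walk_sum \<gamma>' p \<le> - pl v w"
  using \<gamma>_path[of p] walk_sum_\<gamma>'_le[of w p v] by (auto simp: simple_paths_def)

text \<open>The path hypothesis gives \<open>pot v \<le> 0\<close>, the Lipschitz bound along the
  edge from \<open>w\<close> to \<open>v\<close> the converse.\<close>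

lemma pot_v: "pot v = 0"
proof -
  have "simple_paths w v \<noteq> {}"
    using simple_paths_edge[OF adjacent_sym[OF vw]] by auto
  then obtain p where "p \<in> simple_paths w v" "pot v = pl v w + walk_sum \<gamma>' p"
    by (rule pot_attained)
  then have "pot v \<le> 0"
    using walk_sum_\<gamma>'_v by fastforce
  then show ?thesis
    using pot_lipschitz[OF adjacent_sym[OF vw]] pot_w pair_length_sym[of \<omega> v w] by simp
qed

text \<open>The single step competes in the maximum and, leaving \<open>w\<close>, is charged by
  \<open>\<gamma>\<close> itself.\<close>

lemma pot_from_w:
  assumes "adjacent G w u"
  shows "\<gamma> w u \<le> pot u - pot w"
  using pot_ge[OF simple_paths_edge[OF assms]] pot_w by (simp add: \<gamma>'_def)

text \<open>If a maximal path to \<open>u\<close> avoids \<open>v\<close>, prolonging it to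
  \<open>v\<close> gives a path covered by the hypothesis on \<open>\<gamma>\<close>. Otherwise its
  part after \<open>v\<close> costs at least \<open>pl v u\<close>, so
  \<open>pot u \<le> - pl v u\<close>.\<close>

lemma pot_to_v:
  assumes "adjacent G u v"
  shows "\<gamma> u v \<le> pot v - pot u"
proof -
  have "simple_paths w u \<noteq> {}"
    using extend_simple_path[OF simple_paths_edge[OF adjacent_sym[OF vw]] adjacent_sym[OF assms]]
    by blast
  then obtain p where p: "p \<in> simple_paths w u" "pot u = pl v w + walk_sum \<gamma>' p"
    by (rule pot_attained)
  have path: "vertex_path G w p u" and dist: "distinct p"
    using p by (auto simp: simple_paths_def)
  show ?thesis
  proof (cases "v \<in> set p")
    case False
    then have "p @ [v] \<in> simple_paths w v"
      using vertex_path_snoc[OF path assms] dist by (auto simp: simple_paths_def)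
    then have "walk_sum \<gamma> (p @ [v]) \<le> - pl v w"
      by (rule \<gamma>_path)
    moreover have "walk_sum \<gamma> (p @ [v]) = walk_sum \<gamma> p + \<gamma> u v"
      using path by (subst walk_sum_snoc) (auto simp: vertex_path_def)
    ultimately show ?thesis
      using walk_sum_\<gamma>'_le[OF path] p(2) pot_v by simp
  next
    case True
    then obtain p1 p2 where eq: "p = p1 @ v # p2" by (auto simp: in_set_conv_decomp)
    have "walk_sum \<gamma>' (p1 @ [v]) \<le> - pl v w"
      using vertex_path_sub(1)[of w p1 v p2 u] path dist eq
      by (intro walk_sum_\<gamma>'_v) (auto simp: simple_paths_def)
    moreover have "w \<notin> set (v # p2)"
      using path dist eq adjacent_V[OF vw] by (cases p1) (auto simp: vertex_path_def)
    then have "walk_sum \<gamma>' (v # p2) = - walk_sum pl (v # p2)"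
      by (rule walk_sum_\<gamma>')
    moreover have "pl v u \<le> walk_sum pl (v # p2)"
      using path eq vertex_path_sub(2) adjacent_sym[OF assms] by (intro pl_le_walk_sum) auto
    ultimately show ?thesis
      using \<gamma>_le[OF assms] p(2) pot_v eq walk_sum_append[of \<gamma>' p1 v p2] pair_length_sym[of \<omega> u v]
      by simp
  qed
qed

lemma pot_outside: "z \<notin> V \<Longrightarrow> pot z = 0"
proof -
  assume "z \<notin> V"
  then have "simple_paths w z = {}"
    by (fastforce simp: simple_paths_def vertex_path_def dest: last_in_set)
  then show ?thesis by (simp add: pot_def)
qed

end

text \<open>The last two bounds concern the edges at \<open>w\<close> and \<open>v\<close>, which
  are those seen by \<open>lower\<close>; their direction is the one that
  \<open>lower_potential_le\<close> requires.\<close>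

lemma exists_potential:
  assumes "adjacent G v w"
    and "\<And>a b. adjacent G a b \<Longrightarrow> \<bar>\<gamma> a b\<bar> \<le> pl a b"
    and "\<And>p. p \<in> simple_paths w v \<Longrightarrow> walk_sum \<gamma> p \<le> - pl v w"
  obtains f where "f \<in> fun_space G" "f w - f v = pl v w"
    "\<And>a b. adjacent G a b \<Longrightarrow> f a - f b \<le> pl a b"
    "\<And>u. adjacent G w u \<Longrightarrow> \<gamma> w u \<le> f u - f w"
    "\<And>u. adjacent G u v \<Longrightarrow> \<gamma> u v \<le> f v - f u"
proof (rule that[of "pot v w \<gamma>"])
  show "pot v w \<gamma> \<in> fun_space G"
    unfolding fun_space_def using pot_outside[OF assms] cells_eq by blast
  show "pot v w \<gamma> w - pot v w \<gamma> v = pl v w"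
    using pot_w[OF assms] pot_v[OF assms] by simp
qed (use pot_lipschitz[OF assms] pot_from_w[OF assms] pot_to_v[OF assms] in blast)+

end

section \<open>The edge Laplacian of a graph\<close>

context graph_complex
begin

text \<open>The path as a 1-chain, with sign by the direction of travel relative to the orientation
  of the edge.\<close>

definition circulation :: "'a list \<Rightarrow> 'a \<Rightarrow> real" where
  "circulation p e = of_bool ((tail e, head e) \<in> steps p) - of_bool ((head e, tail e) \<in> steps p)"

text \<open>The antisymmetric function on vertex pairs given by \<open>g\<close>; it is \<open>0\<close> on nonadjacent pairs.\<close>

definition oriented :: "('a \<Rightarrow> real) \<Rightarrow> 'a \<Rightarrow> 'a \<Rightarrow> real" where
  "oriented g a b =
    (\<Sum>e\<in>E. (of_bool ((tail e, head e) = (a, b)) - of_bool ((head e, tail e) = (a, b))) * g e)"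

lemma oriented_eq:
  assumes "e \<in> E"
  shows "oriented g (tail e) (head e) = g e" "oriented g (head e) (tail e) = - g e"
proof -
  have "oriented g (tail e) (head e) = (\<Sum>e'\<in>E. if e' = e then g e else 0)"
    unfolding oriented_def
    using edge_unique[OF _ assms] tail_neq_head[OF assms] by (intro sum.cong) (auto simp: doubleton_eq_iff)
  then show "oriented g (tail e) (head e) = g e" using assms by simp
  have "oriented g (head e) (tail e) = (\<Sum>e'\<in>E. if e' = e then - g e else 0)"
    unfolding oriented_def
    using edge_unique[OF _ assms] tail_neq_head[OF assms] by (intro sum.cong) (auto simp: doubleton_eq_iff)
  then show "oriented g (head e) (tail e) = - g e" using assms by simp
qed

text \<open>Distinctness gives a sum over the set of steps; exchanging sums yields the pairing of
  the cochain \<open>g\<close> with the chain of \<open>p\<close>.\<close>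

lemma walk_sum_oriented:
  assumes "distinct p"
  shows "walk_sum (oriented g) p = (\<Sum>e\<in>E. circulation p e * g e)"
proof -
  have *: "(\<Sum>s\<in>steps p. of_bool (a = s)) = (of_bool (a \<in> steps p) :: real)" for a
    by (simp add: of_bool_def)
  have "walk_sum (oriented g) p = (\<Sum>s\<in>steps p. \<Sum>e\<in>E.
      (of_bool ((tail e, head e) = s) - of_bool ((head e, tail e) = s)) * g e)"
    unfolding walk_sum_eq_sum_steps[OF assms] oriented_def by (intro sum.cong) auto
  also have "\<dots> = (\<Sum>e\<in>E. \<Sum>s\<in>steps p.
      (of_bool ((tail e, head e) = s) - of_bool ((head e, tail e) = s)) * g e)"
    by (rule sum.swap)
  also have "\<dots> = (\<Sum>e\<in>E. circulation p e * g e)"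
    unfolding sum_distrib_right[symmetric] sum_subtractf * circulation_def ..
  finally show ?thesis .
qed

lemma sum_V_inc:
  assumes "e \<in> E"
  shows "(\<Sum>u\<in>V. f u * inc u e) = f (head e) - f (tail e)"
proof -
  have "(\<Sum>u\<in>V. f u * inc u e) =
      (\<Sum>u\<in>V. (if u = head e then f u else 0) - (if u = tail e then f u else 0))"
    using inc_eq[OF _ assms] tail_neq_head[OF assms] by (intro sum.cong) auto
  then show ?thesis
    using tail[OF assms] head[OF assms] by (simp add: sum_subtractf)
qed

lemma coboundary_edge:
  assumes "e \<in> E"
  shows "coboundary G f e = f (head e) - f (tail e)"
proof -
  have "(\<Sum>u\<in>cells G. f u * inc u e) = (\<Sum>u\<in>V. f u * inc u e)"
    using finite_cells cells_eq inc_eq_0[of _ e] assms E_dim by (intro sum.mono_neutral_right) auto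
  then show ?thesis
    using assms E_dim sum_V_inc by (simp add: coboundary_def)
qed

lemma coboundary_vertex:
  assumes "u \<in> V"
  shows "coboundary G f u = 0"
proof -
  have "u \<notin> E" using assms V_dim E_dim by fastforce
  then have "(\<Sum>v\<in>cells G. f v * inc v u) = 0"
    using inc_eq_0[of _ u] assms V_dim by (intro sum.neutral) auto
  then show ?thesis by (simp add: coboundary_def)
qed

text \<open>\<open>lower x y\<close> is the entry \<open>\<delta>\<delta>\<^sup>*y(x)\<close>, and \<open>upper x y\<close> below is \<open>\<delta>\<^sup>*\<delta>y(x)\<close>.\<close>

definition lower :: "'a \<Rightarrow> 'a \<Rightarrow> real" where
  "lower x y = (inc (head x) y / weight G (head x) - inc (tail x) y / weight G (tail x)) * weight G y"

text \<open>Coboundaries vanish on vertices, so only edges enter the adjoint; the Ollivier objective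
  is linear in the increments of \<open>f\<close> along edges.\<close>

lemma lower_laplacian_eq:
  assumes "x \<in> E"
  shows "coboundary G (adj_coboundary G (coboundary G f)) x =
    (\<Sum>y\<in>E. lower x y * (f (head y) - f (tail y)))"
proof -
  have "adj_coboundary G (coboundary G f) u =
      (\<Sum>y\<in>E. inc u y / weight G u * weight G y * (f (head y) - f (tail y)))" if "u \<in> V" for u
  proof -
    have "(\<Sum>z\<in>cells G. inc u z * coboundary G f z * weight G z) =
        (\<Sum>z\<in>E. inc u z * coboundary G f z * weight G z)"
      using finite_cells cells_eq coboundary_vertex by (intro sum.mono_neutral_right) auto
    also have "\<dots> = (\<Sum>z\<in>E. inc u z * (f (head z) - f (tail z)) * weight G z)"
      by (intro sum.cong) (auto simp: coboundary_edge)
    finally show ?thesis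
      using that V_dim by (simp add: adj_coboundary_eq sum_divide_distrib algebra_simps)
  qed
  then have "coboundary G (adj_coboundary G (coboundary G f)) x =
      (\<Sum>y\<in>E. inc (head x) y / weight G (head x) * weight G y * (f (head y) - f (tail y))) -
      (\<Sum>y\<in>E. inc (tail x) y / weight G (tail x) * weight G y * (f (head y) - f (tail y)))"
    using head[OF assms] tail[OF assms] by (simp add: coboundary_edge assms)
  then show ?thesis
    unfolding lower_def sum_subtractf[symmetric] left_diff_distrib .
qed

end

section \<open>Complexes with a given 1-skeleton\<close>

locale complex_extension = graph_complex G + K: cell_complex K for G K :: "'a cell_structure" +
  assumes skeleton: "has_one_skeleton K G"
begin

definition upper :: "'a \<Rightarrow> 'a \<Rightarrow> real" where
  "upper x y = (\<Sum>z\<in>cells K. incidence K x z * incidence K y z * weight K z) / weight G x"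

lemma cells_K_dim:
  "cells_of_dim K 0 = V" "cells_of_dim K 1 = E"
  "u \<in> V \<Longrightarrow> u \<in> cells K \<and> cell_dim K u = 0"
  "e \<in> E \<Longrightarrow> e \<in> cells K \<and> cell_dim K e = 1"
proof -
  show V: "cells_of_dim K 0 = V" and E: "cells_of_dim K 1 = E"
    using skeleton by (simp_all add: has_one_skeleton_def E_def)
  show "u \<in> cells K \<and> cell_dim K u = 0" if "u \<in> V"
    using that unfolding V[symmetric] by (simp add: cells_of_dim_def)
  show "e \<in> cells K \<and> cell_dim K e = 1" if "e \<in> E"
    using that unfolding E[symmetric] by (simp add: cells_of_dim_def)
qed

lemma skeleton_eq:
  "a \<in> cells G \<Longrightarrow> b \<in> cells G \<Longrightarrow> incidence K a b = inc a b"
  "a \<in> cells G \<Longrightarrow> weight K a = weight G a"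
  using skeleton by (simp_all add: has_one_skeleton_def)

lemma incidence_K_edge_eq_0:
  assumes "u \<in> cells K" "e \<in> E" "u \<notin> V"
  shows "incidence K u e = 0"
proof (rule K.incidence_dim)
  show "cell_dim K e \<noteq> cell_dim K u + 1"
    using assms cells_K_dim(4)[of e] unfolding cells_K_dim(1)[symmetric]
    by (simp add: cells_of_dim_def)
qed (use assms cells_K_dim(4) in auto)

text \<open>The part through vertices agrees in \<open>K\<close> and \<open>G\<close>; higher cells
  enter only through \<open>upper\<close>.\<close>

lemma hodge_edge:
  assumes x: "x \<in> E" and y: "y \<in> E"
  shows "hodge_laplacian K (indicator {y}) x = lower x y + upper x y"
proof -
  have y': "y \<in> cells K" and x': "x \<in> cells K" using x y cells_K_dim(4) by auto
  have adj: "adj_coboundary K (indicator {y}) u = inc u y / weight G u * weight G y" if "u \<in> V" for u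
  proof -
    have "(\<Sum>z\<in>cells K. incidence K u z * indicator {y} z * weight K z) =
        (\<Sum>z\<in>cells K. if z = y then incidence K u y * weight K y else 0)"
      by (intro sum.cong) auto
    then show ?thesis
      using y' K.finite_cells cells_K_dim(3)[OF that] skeleton_eq V_dim[OF that] E_dim[OF y]
      by (simp add: K.adj_coboundary_eq)
  qed
  have "coboundary K (adj_coboundary K (indicator {y})) x =
      (\<Sum>u\<in>cells K. adj_coboundary K (indicator {y}) u * incidence K u x)"
    using x' by (simp add: coboundary_def)
  also have "\<dots> = (\<Sum>u\<in>V. adj_coboundary K (indicator {y}) u * incidence K u x)"
    using incidence_K_edge_eq_0[OF _ x] K.finite_cells cells_K_dim(3)
    by (intro sum.mono_neutral_right) auto
  also have "\<dots> = (\<Sum>u\<in>V. inc u y / weight G u * weight G y * inc u x)"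
    using adj skeleton_eq V_dim E_dim[OF x] by (intro sum.cong) auto
  also have "\<dots> = lower x y"
    unfolding sum_V_inc[OF x] lower_def left_diff_distrib ..
  finally have "coboundary K (adj_coboundary K (indicator {y})) x = lower x y" .
  moreover have "adj_coboundary K (coboundary K (indicator {y})) x = upper x y"
    using x' y' E_dim[OF x] skeleton_eq
    by (simp add: K.adj_coboundary_eq upper_def coboundary_indicator K.finite_cells)
  ultimately show ?thesis by (simp add: hodge_laplacian_def)
qed

text \<open>The double coboundary vanishes: by \<open>diamond\<close> there are either no
  intermediate edges or two with products 1 and -1.\<close>

lemma diamond_sum:
  assumes u: "u \<in> V" and z: "z \<in> cells K"
  shows "(\<Sum>y\<in>E. inc u y * incidence K y z) = 0"
proof -
  let ?S = "{y. face K u y \<and> face K y z}"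
  have inc: "incidence K u y = inc u y" if "y \<in> E" for y
    using skeleton_eq u V_dim E_dim that by auto
  have "y \<in> E" if "face K u y" for y
    using that K.incidence_dim[of u y] cells_K_dim(3)[OF u] unfolding cells_K_dim(2)[symmetric]
    by (auto simp: face_def cells_of_dim_def)
  then have sub: "?S \<subseteq> E" by auto
  have "(\<Sum>y\<in>E. inc u y * incidence K y z) = (\<Sum>y\<in>?S. incidence K u y * incidence K y z)"
    using sub z cells_K_dim(3)[OF u] cells_K_dim(4) inc by (intro sum.mono_neutral_cong_right) (auto simp: face_def)
  also have "\<dots> = 0"
  proof (cases "?S = {}")
    case False
    then obtain y where "face K u y" "face K y z" by auto
    then have "cell_dim K y = cell_dim K u + 1" "cell_dim K z = cell_dim K y + 1"
      using K.incidence_dim[of u y] K.incidence_dim[of y z] unfolding face_def by blast+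
    then have "cell_dim K z = cell_dim K u + 2" by simp
    then have S: "card ?S = 2" "{-1, 1} \<subseteq> {incidence K u y * incidence K y z |y. y \<in> cells K}"
      using K.diamond[OF _ z _ False] cells_K_dim(3)[OF u] by auto
    then obtain y1 y2 where y12: "y1 \<in> cells K" "y2 \<in> cells K"
        "incidence K u y1 * incidence K y1 z = 1" "incidence K u y2 * incidence K y2 z = -1"
      by fastforce
    then have "{y1, y2} \<subseteq> ?S" "y1 \<noteq> y2"
      using z cells_K_dim(3)[OF u] by (auto simp: face_def)
    then have "?S = {y1, y2}"
      using S(1) by (metis card_2_iff card_subset_eq card.infinite zero_neq_numeral)
    then show ?thesis using y12 \<open>y1 \<noteq> y2\<close> by simp
  next
    case True
    then show ?thesis by (simp only: sum.empty)
  qed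
  finally show ?thesis .
qed

text \<open>Each \<open>z\<close> contributes a multiple of the double coboundary of
  \<open>f\<close> at \<open>z\<close>. Hence competitors in the Ollivier infimum do not see
  \<open>upper\<close>.\<close>

lemma upper_coboundary: "(\<Sum>y\<in>E. upper x y * (f (head y) - f (tail y))) = 0"
proof -
  have *: "(\<Sum>y\<in>E. incidence K y z * (f (head y) - f (tail y))) = 0" if "z \<in> cells K" for z
  proof -
    have "(\<Sum>y\<in>E. incidence K y z * (f (head y) - f (tail y))) =
        (\<Sum>y\<in>E. \<Sum>u\<in>V. f u * (inc u y * incidence K y z))"
      by (intro sum.cong) (auto simp: sum_V_inc[symmetric] sum_distrib_left algebra_simps)
    also have "\<dots> = (\<Sum>u\<in>V. f u * (\<Sum>y\<in>E. inc u y * incidence K y z))"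
      by (subst sum.swap) (simp add: sum_distrib_left)
    finally show ?thesis using diamond_sum that by simp
  qed
  have "(\<Sum>y\<in>E. upper x y * (f (head y) - f (tail y))) =
      (\<Sum>y\<in>E. \<Sum>z\<in>cells K. incidence K x z * weight K z / weight G x *
        (incidence K y z * (f (head y) - f (tail y))))"
    unfolding upper_def sum_divide_distrib sum_distrib_right by (intro sum.cong refl) simp
  also have "\<dots> = (\<Sum>z\<in>cells K. incidence K x z * weight K z / weight G x *
        (\<Sum>y\<in>E. incidence K y z * (f (head y) - f (tail y))))"
    by (subst sum.swap) (simp add: sum_distrib_left)
  finally show ?thesis using * by simp
qed

lemma forman_eq:
  assumes x: "x \<in> E" and "0 < \<omega> x"
  shows "\<omega> x * forman_curvature K \<omega> x =
    (lower x x + upper x x) * \<omega> x - (\<Sum>y\<in>E - {x}. \<bar>lower x y + upper x y\<bar> * \<omega> y)"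
proof -
  have *: "(\<Sum>y\<in>E - {x}. \<omega> y / \<omega> x * \<bar>hodge_laplacian K (indicator {y}) x\<bar>) =
      (\<Sum>y\<in>E - {x}. \<bar>lower x y + upper x y\<bar> * \<omega> y) / \<omega> x"
    unfolding sum_divide_distrib by (intro sum.cong) (auto simp: hodge_edge x)
  show ?thesis
    unfolding forman_curvature_def cells_K_dim(2) * hodge_edge[OF x x]
    using assms by (simp add: field_simps)
qed

text \<open>Weak duality: off \<open>x\<close> each term is at least minus its absolute bound, at
  \<open>x\<close> the increment is exactly \<open>\<omega> x\<close>, and \<open>upper\<close>
  drops out of the sum.\<close>

lemma forman_le_lower_laplacian:
  assumes x: "x \<in> E" and "0 < \<omega> x" and fx: "f (head x) - f (tail x) = \<omega> x"
    and f: "\<And>y. y \<in> E \<Longrightarrow> \<bar>f (head y) - f (tail y)\<bar> \<le> \<omega> y"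
  shows "\<omega> x * forman_curvature K \<omega> x \<le> coboundary G (adj_coboundary G (coboundary G f)) x"
proof -
  let ?d = "\<lambda>y. f (head y) - f (tail y)"
  have "- (\<bar>lower x y + upper x y\<bar> * \<omega> y) \<le> (lower x y + upper x y) * ?d y" if "y \<in> E" for y
  proof -
    have "\<bar>(lower x y + upper x y) * ?d y\<bar> \<le> \<bar>lower x y + upper x y\<bar> * \<omega> y"
      unfolding abs_mult using f[OF that] by (intro mult_left_mono) auto
    then show ?thesis by linarith
  qed
  then have "- (\<Sum>y\<in>E - {x}. \<bar>lower x y + upper x y\<bar> * \<omega> y) \<le>
      (\<Sum>y\<in>E - {x}. (lower x y + upper x y) * ?d y)"
    unfolding sum_negf[symmetric] by (intro sum_mono) auto
  then have "\<omega> x * forman_curvature K \<omega> x \<le> (\<Sum>y\<in>E. (lower x y + upper x y) * ?d y)"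
    unfolding forman_eq[of x \<omega>, OF assms(1,2)] by (simp add: sum.remove[OF _ x] fx)
  also have "\<dots> = (\<Sum>y\<in>E. lower x y * ?d y)"
    unfolding distrib_right sum.distrib upper_coboundary by simp
  finally show ?thesis by (simp add: lower_laplacian_eq[OF x])
qed

end

section \<open>Linear programming duality\<close>

context weighted_graph_complex
begin

text \<open>The Ollivier constraints on edges; on vertices they hold since the coboundary vanishes
  there.\<close>

definition admissible :: "'a \<Rightarrow> ('a \<Rightarrow> real) \<Rightarrow> bool" where
  "admissible x f \<longleftrightarrow> f \<in> fun_space G \<and> f (head x) - f (tail x) = \<omega> x \<and>
    (\<forall>y\<in>E. \<bar>f (head y) - f (tail y)\<bar> \<le> \<omega> y)"

lemma pl_ends: "e \<in> E \<Longrightarrow> pl (tail e) (head e) = \<omega> e" "e \<in> E \<Longrightarrow> pl (head e) (tail e) = \<omega> e"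
  by (auto intro!: pair_length_eq)

lemma admissibleI:
  assumes "x \<in> E" "f \<in> fun_space G" "f (head x) - f (tail x) = \<omega> x"
    and "\<And>a b. adjacent G a b \<Longrightarrow> f a - f b \<le> pl a b"
  shows "admissible x f"
  unfolding admissible_def
proof (intro conjI ballI assms)
  fix y assume "y \<in> E"
  then show "\<bar>f (head y) - f (tail y)\<bar> \<le> \<omega> y"
    using assms(4)[OF adjacent_ends(1)[of y]] assms(4)[OF adjacent_ends(2)[of y]] pl_ends[of y]
    by linarith
qed

text \<open>For the increments \<open>- pl\<close> the path hypothesis is nondegeneracy. This makes
  the set under the Ollivier infimum nonempty.\<close>

lemma admissible_exists:
  assumes x: "x \<in> E"
  obtains f where "admissible x f"
proof (rule exists_potential[of "tail x" "head x" "\<lambda>a b. - pl a b"])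
  show "walk_sum (\<lambda>a b. - pl a b) p \<le> - pl (tail x) (head x)"
    if "p \<in> simple_paths (head x) (tail x)" for p
    using pl_le_walk_sum[OF adjacent_ends(2)[OF x], of p] that pl_ends[OF x]
    by (simp add: simple_paths_def walk_sum_uminus)
  show thesis
    if "f \<in> fun_space G" "f (head x) - f (tail x) = pl (tail x) (head x)"
      "\<And>a b. adjacent G a b \<Longrightarrow> f a - f b \<le> pl a b" for f
    using that x pl_ends(1) by (intro \<open>\<And>f. admissible x f \<Longrightarrow> thesis\<close>[OF admissibleI]) auto
qed (use adjacent_ends(1)[OF x] pl_pos in \<open>auto simp: less_imp_le\<close>)

text \<open>The edge \<open>x\<close> alone is left out, since it would close up with
  \<open>x\<close> to a degenerate cycle.\<close>

definition detours :: "'a \<Rightarrow> 'a list set" where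
  "detours x = simple_paths (head x) (tail x) - {[head x, tail x]}"

lemma finite_detours [simp]: "finite (detours x)"
  by (simp add: detours_def)

text \<open>A distinct path never returns to its start, and once it reaches its end it is over, so a
  direct step would be the whole path.\<close>

lemma detours_steps:
  assumes x: "x \<in> E" and p: "p \<in> detours x"
  shows "(tail x, head x) \<notin> steps p" "(head x, tail x) \<notin> steps p"
proof -
  have dist: "distinct p" and hd: "hd p = head x" and last: "last p = tail x" "p \<noteq> []"
    and neq: "p \<noteq> [head x, tail x]"
    using p by (auto simp: detours_def simple_paths_def vertex_path_def)
  show "(tail x, head x) \<notin> steps p"
    using steps_snd_not_hd[OF dist] hd by auto
  show "(head x, tail x) \<notin> steps p"
  proof
    assume step: "(head x, tail x) \<in> steps p"
    then obtain b r where eq: "p = head x # b # r"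
      using hd by (cases p rule: steps.cases) auto
    then have "b = tail x"
      using step dist steps_subset[of "b # r"] by auto
    then have "r = []"
      using last dist eq by (cases r rule: rev_cases) auto
    then show False using neq eq \<open>b = tail x\<close> by simp
  qed
qed

lemma detours_circulation: "x \<in> E \<Longrightarrow> p \<in> detours x \<Longrightarrow> circulation p x = 0"
  using detours_steps by (simp add: circulation_def)

text \<open>Only edges meeting an end of \<open>x\<close> count. Larger increments out of
  \<open>head x\<close> or into \<open>tail x\<close> lower the contribution of the entry, whatever
  the orientation of \<open>y\<close>.\<close>

lemma lower_potential_le:
  assumes x: "x \<in> E" and y: "y \<in> E"
    and f1: "\<And>u. adjacent G (head x) u \<Longrightarrow> oriented g (head x) u \<le> f u - f (head x)"
    and f2: "\<And>u. adjacent G u (tail x) \<Longrightarrow> oriented g u (tail x) \<le> f (tail x) - f u"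
  shows "lower x y * (f (head y) - f (tail y)) \<le> lower x y * g y"
proof -
  let ?d = "f (head y) - f (tail y)"
  note ends = adjacent_ends[OF y] oriented_eq[OF y, of g] tail_neq_head[OF y]
  have "inc (head x) y * ?d \<le> inc (head x) y * g y"
    unfolding inc_eq[OF head(1)[OF x] y] using f1[of "tail y"] f1[of "head y"] ends
    by (cases "head x = head y"; cases "head x = tail y") auto
  moreover have "inc (tail x) y * g y \<le> inc (tail x) y * ?d"
    unfolding inc_eq[OF tail(1)[OF x] y] using f2[of "tail y"] f2[of "head y"] ends
    by (cases "tail x = head y"; cases "tail x = tail y") auto
  moreover have "0 < weight G (head x)" "0 < weight G (tail x)" "0 < weight G y"
    using weight_pos V_dim E_dim head(1)[OF x] tail(1)[OF x] y by auto
  ultimately have "(inc (head x) y * ?d / weight G (head x) - inc (tail x) y * ?d / weight G (tail x)) * weight G y \<le>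
     (inc (head x) y * g y / weight G (head x) - inc (tail x) y * g y / weight G (tail x)) * weight G y"
    by (intro mult_right_mono diff_mono divide_right_mono) auto
  then show ?thesis
    by (simp add: lower_def algebra_simps)
qed

text \<open>
  In the linear program, \<open>Inl p\<close> indexes the weight \<open>t p\<close> and \<open>Inr y\<close> an upper bound for the absolute
  value of the row entry at \<open>y\<close>. The predicate \<open>P\<close> describes the consequences of the constraints:
  \<open>r\<close> is the multiplier of the objective and \<open>g y\<close> the difference of the multipliers of the two
  constraints at \<open>y\<close>.
\<close>

lemma detour_weights:
  assumes x: "x \<in> E"
    and M: "\<And>f. admissible x f \<Longrightarrow> M \<le> (\<Sum>y\<in>E. lower x y * (f (head y) - f (tail y)))"
  obtains t where "\<And>p. p \<in> detours x \<Longrightarrow> 0 \<le> t p"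
    "M \<le> (lower x x + (\<Sum>p\<in>detours x. t p)) * \<omega> x -
       (\<Sum>y\<in>E - {x}. \<bar>lower x y + (\<Sum>p\<in>detours x. t p * circulation p y)\<bar> * \<omega> y)"
proof -
  let ?Q = "detours x" and ?E = "E - {x}"
  let ?J = "Inl ` ?Q \<union> Inr ` ?E"
  \<comment> \<open>\<open>S1\<close> says that weights are nonnegative, \<open>S2\<close> and
    \<open>S3\<close> bound the row entries from both sides, and the row of \<open>c\<close> makes
    the objective at least \<open>M\<close>.\<close>
  define S1 where "S1 = (\<lambda>p. (case_sum (\<lambda>q. if q = p then -1 else 0) (\<lambda>_ :: 'a. 0 :: real), 0 :: real)) ` ?Q"
  define S2 where "S2 = (\<lambda>y. (case_sum (\<lambda>q. circulation q y) (\<lambda>y'. if y' = y then -1 else 0), - lower x y)) ` ?E"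
  define S3 where "S3 = (\<lambda>y. (case_sum (\<lambda>q. - circulation q y) (\<lambda>y'. if y' = y then -1 else 0), lower x y)) ` ?E"
  define c where "c = (case_sum (\<lambda>_. - \<omega> x) \<omega> :: 'a list + 'a \<Rightarrow> real)"
  define S where "S = insert (c, lower x x * \<omega> x - M) (S1 \<union> S2 \<union> S3)"
  define P where "P = (\<lambda>(a :: 'a list + 'a \<Rightarrow> real) b. \<exists>g r. 0 \<le> r \<and>
    (\<forall>p\<in>?Q. a (Inl p) \<le> - (\<Sum>y\<in>?E. circulation p y * g y) - r * \<omega> x) \<and>
    (\<forall>y\<in>?E. a (Inr y) \<le> r * \<omega> y - \<bar>g y\<bar>) \<and>
    (\<Sum>y\<in>?E. lower x y * g y) + r * (lower x x * \<omega> x - M) \<le> b)"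
  have "(\<exists>t. \<forall>(a, b)\<in>S. (\<Sum>j\<in>?J. a j * t j) \<le> b) \<or> (\<exists>a b. P a b \<and> (\<forall>j\<in>?J. a j = 0) \<and> b < 0)"
  proof (rule farkas_cone)
    show "finite ?J" "finite S"
      by (auto simp: S_def S1_def S2_def S3_def)
    fix a b a' b'
    show "P a b" if ab: "(a, b) \<in> S"
    proof -
      \<comment> \<open>The objective row has \<open>r = 1\<close> and \<open>g = 0\<close>, a row
        of \<open>S1\<close> has both 0, and a row of \<open>S2\<close> or \<open>S3\<close> has
        \<open>r = 0\<close> and \<open>g\<close> equal to -1 or 1 at its edge.\<close>
      consider "(a, b) = (c, lower x x * \<omega> x - M)" | "(a, b) \<in> S1" | "(a, b) \<in> S2" | "(a, b) \<in> S3"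
        using ab by (auto simp: S_def)
      then show ?thesis
      proof cases
        case 1
        then show ?thesis unfolding P_def c_def by (intro exI[of _ "\<lambda>_. 0"] exI[of _ 1]) auto
      next
        case 2
        then show ?thesis unfolding P_def S1_def by (intro exI[of _ "\<lambda>_. 0"] exI[of _ 0]) auto
      next
        case 3
        then obtain y where y: "y \<in> ?E"
            "a = case_sum (\<lambda>q. circulation q y) (\<lambda>y'. if y' = y then -1 else 0)" "b = - lower x y"
          unfolding S2_def by blast
        have "(\<Sum>z\<in>?E. h z * (if z = y then -1 else 0)) = - h y" for h :: "'a \<Rightarrow> real"
          using y(1) by (simp add: if_distrib[of "\<lambda>t. _ * t"] cong: if_cong)
        then show ?thesis
          unfolding P_def y(2,3) by (intro exI[of _ "\<lambda>z. if z = y then -1 else 0"] exI[of _ 0]) auto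
      next
        case 4
        then obtain y where y: "y \<in> ?E"
            "a = case_sum (\<lambda>q. - circulation q y) (\<lambda>y'. if y' = y then -1 else 0)" "b = lower x y"
          unfolding S3_def by blast
        have "(\<Sum>z\<in>?E. h z * (if z = y then 1 else 0)) = h y" for h :: "'a \<Rightarrow> real"
          using y(1) by (simp add: if_distrib[of "\<lambda>t. _ * t"] cong: if_cong)
        then show ?thesis
          unfolding P_def y(2,3) by (intro exI[of _ "\<lambda>z. if z = y then 1 else 0"] exI[of _ 0]) auto
      qed
    qed
    show "P (\<lambda>j. a j + a' j) (b + b')" if P1: "P a b" and P2: "P a' b'"
    proof -
      obtain g r where 1: "0 \<le> r"
          "\<forall>p\<in>?Q. a (Inl p) \<le> - (\<Sum>y\<in>?E. circulation p y * g y) - r * \<omega> x"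
          "\<forall>y\<in>?E. a (Inr y) \<le> r * \<omega> y - \<bar>g y\<bar>"
          "(\<Sum>y\<in>?E. lower x y * g y) + r * (lower x x * \<omega> x - M) \<le> b"
        using P1 unfolding P_def by blast
      obtain g' r' where 2: "0 \<le> r'"
          "\<forall>p\<in>?Q. a' (Inl p) \<le> - (\<Sum>y\<in>?E. circulation p y * g' y) - r' * \<omega> x"
          "\<forall>y\<in>?E. a' (Inr y) \<le> r' * \<omega> y - \<bar>g' y\<bar>"
          "(\<Sum>y\<in>?E. lower x y * g' y) + r' * (lower x x * \<omega> x - M) \<le> b'"
        using P2 unfolding P_def by blast
      show ?thesis
        unfolding P_def
      proof (intro exI[of _ "\<lambda>y. g y + g' y"] exI[of _ "r + r'"] conjI ballI)
        fix p assume "p \<in> ?Q"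
        then show "a (Inl p) + a' (Inl p) \<le> - (\<Sum>y\<in>?E. circulation p y * (g y + g' y)) - (r + r') * \<omega> x"
          using 1(2) 2(2) by (fastforce simp: distrib_left distrib_right sum.distrib)
      next
        fix y assume "y \<in> ?E"
        then have "a (Inr y) \<le> r * \<omega> y - \<bar>g y\<bar>" "a' (Inr y) \<le> r' * \<omega> y - \<bar>g' y\<bar>"
          using 1(3) 2(3) by auto
        then show "a (Inr y) + a' (Inr y) \<le> (r + r') * \<omega> y - \<bar>g y + g' y\<bar>"
          unfolding distrib_right by linarith
      next
        show "(\<Sum>y\<in>?E. lower x y * (g y + g' y)) + (r + r') * (lower x x * \<omega> x - M) \<le> b + b'"
          unfolding distrib_left distrib_right[of r r'] sum.distrib using 1(4) 2(4) by linarith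
      qed (use 1 2 in simp)
    qed
    show "P (\<lambda>j. s * a j) (s * b)" if "P a b" and s: "0 < s" for s
    proof -
      obtain g r where 1: "0 \<le> r"
          "\<forall>p\<in>?Q. a (Inl p) \<le> - (\<Sum>y\<in>?E. circulation p y * g y) - r * \<omega> x"
          "\<forall>y\<in>?E. a (Inr y) \<le> r * \<omega> y - \<bar>g y\<bar>"
          "(\<Sum>y\<in>?E. lower x y * g y) + r * (lower x x * \<omega> x - M) \<le> b"
        using \<open>P a b\<close> unfolding P_def by blast
      have sum: "(\<Sum>y\<in>?E. h y * (s * g y)) = s * (\<Sum>y\<in>?E. h y * g y)" for h
        by (simp add: sum_distrib_left algebra_simps)
      show ?thesis
        unfolding P_def
      proof (intro exI[of _ "\<lambda>y. s * g y"] exI[of _ "s * r"] conjI ballI)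
        fix p assume "p \<in> ?Q"
        then have "s * a (Inl p) \<le> s * (- (\<Sum>y\<in>?E. circulation p y * g y) - r * \<omega> x)"
          using 1(2) s by (intro mult_left_mono) auto
        then show "s * a (Inl p) \<le> - (\<Sum>y\<in>?E. circulation p y * (s * g y)) - s * r * \<omega> x"
          unfolding sum by (simp add: algebra_simps)
      next
        fix y assume "y \<in> ?E"
        then have "s * a (Inr y) \<le> s * (r * \<omega> y - \<bar>g y\<bar>)"
          using 1(3) s by (intro mult_left_mono) auto
        then show "s * a (Inr y) \<le> s * r * \<omega> y - \<bar>s * g y\<bar>"
          using s by (simp add: abs_mult algebra_simps)
      next
        have "s * ((\<Sum>y\<in>?E. lower x y * g y) + r * (lower x x * \<omega> x - M)) \<le> s * b"
          using 1(4) s by (intro mult_left_mono) auto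
        then show "(\<Sum>y\<in>?E. lower x y * (s * g y)) + s * r * (lower x x * \<omega> x - M) \<le> s * b"
          unfolding sum by (simp add: algebra_simps)
      qed (use 1 s in simp)
    qed
  qed
  then show thesis
  proof
    assume "\<exists>t. \<forall>(a, b)\<in>S. (\<Sum>j\<in>?J. a j * t j) \<le> b"
    then obtain t where t: "\<And>a b. (a, b) \<in> S \<Longrightarrow> (\<Sum>j\<in>?J. a j * t j) \<le> b" by blast
    have sum_J: "(\<Sum>j\<in>?J. h j) = (\<Sum>p\<in>?Q. h (Inl p)) + (\<Sum>y\<in>?E. h (Inr y))" for h :: "_ \<Rightarrow> real"
      by (subst sum.union_disjoint) (auto simp: sum.reindex)
    let ?t = "\<lambda>p. t (Inl p)"
    have delta: "(\<Sum>z\<in>A. (if z = y then - 1 else 0) * h z) = - h y" if "finite A" "y \<in> A"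
      for A :: "'b set" and y and h :: "'b \<Rightarrow> real"
      using that by (simp add: if_distrib[of "\<lambda>t. t * _"] cong: if_cong)
    show thesis
    proof (rule that[of ?t])
      fix p assume p: "p \<in> ?Q"
      then have "(\<Sum>j\<in>?J. case_sum (\<lambda>q. if q = p then -1 else 0) (\<lambda>_. 0) j * t j) \<le> 0"
        by (intro t) (auto simp: S_def S1_def)
      then show "0 \<le> ?t p"
        unfolding sum_J using p by (simp add: delta)
    next
      have abs: "\<bar>lower x y + (\<Sum>p\<in>?Q. ?t p * circulation p y)\<bar> \<le> t (Inr y)" if y: "y \<in> ?E" for y
      proof -
        have "(\<Sum>j\<in>?J. case_sum (\<lambda>q. circulation q y) (\<lambda>y'. if y' = y then -1 else 0) j * t j) \<le> - lower x y"
          by (intro t) (use y in \<open>auto simp: S_def S2_def\<close>)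
        then have "(\<Sum>p\<in>?Q. ?t p * circulation p y) - t (Inr y) \<le> - lower x y"
          unfolding sum_J using delta[OF _ y] by (simp add: mult.commute)
        moreover have "(\<Sum>j\<in>?J. case_sum (\<lambda>q. - circulation q y) (\<lambda>y'. if y' = y then -1 else 0) j * t j) \<le> lower x y"
          by (intro t) (use y in \<open>auto simp: S_def S3_def\<close>)
        then have "- (\<Sum>p\<in>?Q. ?t p * circulation p y) - t (Inr y) \<le> lower x y"
          unfolding sum_J using delta[OF _ y] by (simp add: sum_negf mult.commute)
        ultimately show ?thesis by linarith
      qed
      have "(\<Sum>j\<in>?J. c j * t j) \<le> lower x x * \<omega> x - M"
        by (intro t) (simp add: S_def)
      then have "M \<le> (lower x x + (\<Sum>p\<in>?Q. ?t p)) * \<omega> x - (\<Sum>y\<in>?E. t (Inr y) * \<omega> y)"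
        unfolding sum_J by (simp add: c_def algebra_simps sum_negf sum_distrib_left sum_distrib_right)
      \<comment> \<open>Replacing \<open>t (Inr y)\<close> by the absolute value below it can only
        raise the bound.\<close>
      also have "\<dots> \<le> (lower x x + (\<Sum>p\<in>?Q. ?t p)) * \<omega> x -
          (\<Sum>y\<in>?E. \<bar>lower x y + (\<Sum>p\<in>?Q. ?t p * circulation p y)\<bar> * \<omega> y)"
        using abs \<omega>_pos E_dim by (intro diff_left_mono sum_mono mult_right_mono) (auto simp: less_imp_le)
      finally show "M \<le> \<dots>" .
    qed
  next
    assume "\<exists>a b. P a b \<and> (\<forall>j\<in>?J. a j = 0) \<and> b < 0"
    then obtain a b where "P a b" and a0: "\<forall>j\<in>?J. a j = 0" and b: "b < 0" by blast
    then obtain g r where r: "0 \<le> r"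
        and gQ: "\<forall>p\<in>?Q. a (Inl p) \<le> - (\<Sum>y\<in>?E. circulation p y * g y) - r * \<omega> x"
        and gE: "\<forall>y\<in>?E. a (Inr y) \<le> r * \<omega> y - \<bar>g y\<bar>"
        and gb: "(\<Sum>y\<in>?E. lower x y * g y) + r * (lower x x * \<omega> x - M) \<le> b"
      unfolding P_def by blast
    \<comment> \<open>For \<open>r = 0\<close> the function \<open>g\<close> would vanish off
      \<open>x\<close>, contradicting \<open>b < 0\<close>.\<close>
    have "r \<noteq> 0"
    proof
      assume "r = 0"
      then have "g y = 0" if "y \<in> ?E" for y
        using gE a0 that by fastforce
      then show False using gb b \<open>r = 0\<close> by simp
    qed
    then have r: "0 < r" using r by simp
    \<comment> \<open>Rescaling makes the certificate an edge function bounded by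
      \<open>\<omega>\<close>; its value at \<open>x\<close> is the one required of
      competitors.\<close>
    define h where "h y = (if y = x then \<omega> x else g y / r)" for y
    have h_sum: "(\<Sum>y\<in>?E. k y * h y) = (\<Sum>y\<in>?E. k y * g y) / r" for k
      unfolding sum_divide_distrib by (intro sum.cong) (auto simp: h_def)
    have h_le: "\<bar>h y\<bar> \<le> \<omega> y" if "y \<in> E" for y
    proof (cases "y = x")
      case False
      then have "\<bar>g y\<bar> \<le> r * \<omega> y" using gE a0 that by fastforce
      then show ?thesis using r False by (simp add: h_def abs_divide field_simps)
    qed (use \<omega>_pos E_dim x in \<open>auto simp: h_def less_imp_le\<close>)
    \<comment> \<open>For the edge \<open>x\<close> alone this is the choice of \<open>h x\<close>;
      for detours it is the inequality stored in the certificate.\<close>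
    have h_path: "walk_sum (oriented h) p \<le> - pl (tail x) (head x)"
      if p: "p \<in> simple_paths (head x) (tail x)" for p
    proof (cases "p = [head x, tail x]")
      case True
      then show ?thesis
        using pl_ends[OF x] by (simp add: oriented_eq[OF x] h_def)
    next
      case False
      then have Q: "p \<in> ?Q" using p by (simp add: detours_def)
      have "walk_sum (oriented h) p = (\<Sum>y\<in>E. circulation p y * h y)"
        using p by (intro walk_sum_oriented) (simp add: simple_paths_def)
      also have "\<dots> = (\<Sum>y\<in>?E. circulation p y * h y)"
        using sum.remove[OF finite_VE(2) x, of "\<lambda>y. circulation p y * h y"] detours_circulation[OF x Q]
        by simp
      also have "\<dots> \<le> - \<omega> x"
      proof -
        have "(\<Sum>y\<in>?E. circulation p y * g y) \<le> - r * \<omega> x"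
          using gQ a0 Q by fastforce
        then show ?thesis unfolding h_sum using r by (simp add: field_simps)
      qed
      finally show ?thesis using pl_ends[OF x] by simp
    qed
    have h_adj: "\<bar>oriented h u u'\<bar> \<le> pl u u'" if adj: "adjacent G u u'" for u u'
    proof -
      obtain e where "e \<in> E" "{tail e, head e} = {u, u'}" using adj by (auto simp: adjacent_iff)
      then show ?thesis
        using h_le[of e] oriented_eq[of e h] pl_ends[of e] by (auto simp: doubleton_eq_iff)
    qed
    obtain f where f: "f \<in> fun_space G" "f (head x) - f (tail x) = pl (tail x) (head x)"
      "\<And>a b. adjacent G a b \<Longrightarrow> f a - f b \<le> pl a b"
      "\<And>u. adjacent G (head x) u \<Longrightarrow> oriented h (head x) u \<le> f u - f (head x)"
      "\<And>u. adjacent G u (tail x) \<Longrightarrow> oriented h u (tail x) \<le> f (tail x) - f u"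
      using exists_potential[OF adjacent_ends(1)[OF x] h_adj h_path] by blast
    \<comment> \<open>The potential is a competitor whose objective is at most that of
      \<open>h\<close>, and the certificate puts the latter below \<open>M\<close>.\<close>
    have "M \<le> (\<Sum>y\<in>E. lower x y * (f (head y) - f (tail y)))"
      using f pl_ends[OF x] x by (intro M admissibleI) auto
    also have "\<dots> \<le> (\<Sum>y\<in>E. lower x y * h y)"
      using lower_potential_le[OF x _ f(4,5)] by (intro sum_mono)
    also have "\<dots> = lower x x * \<omega> x + (\<Sum>y\<in>?E. lower x y * g y) / r"
      using sum.remove[OF finite_VE(2) x, of "\<lambda>y. lower x y * h y"] by (simp add: h_sum) (simp add: h_def)
    also have "\<dots> < M"
    proof -
      have "(\<Sum>y\<in>?E. lower x y * g y) < r * (M - lower x x * \<omega> x)"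
        using gb b by (simp add: algebra_simps)
      then show ?thesis using r by (simp add: field_simps)
    qed
    finally show thesis by simp
  qed
qed

end

section \<open>Filling cycles with 2-cells\<close>

text \<open>Only detours of positive weight get a cell, as cell weights are positive;
  \<open>\<iota>\<close> supplies fresh names.\<close>

locale detour_filling = weighted_graph_complex +
  fixes x :: 'a and T :: "'a list set" and \<iota> :: "'a list \<Rightarrow> 'a" and t :: "'a list \<Rightarrow> real"
  assumes x: "x \<in> E"
    and T: "T \<subseteq> detours x"
    and \<iota>_inj: "inj_on \<iota> T"
    and \<iota>_new: "\<iota> ` T \<inter> cells G = {}"
    and t_pos: "p \<in> T \<Longrightarrow> 0 < t p"
begin

text \<open>
  The 2-cell \<open>\<iota> p\<close> is attached along the closed walk \<open>tail x # p\<close>, which runs through \<open>x\<close> and then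
  back along \<open>p\<close>.
\<close>

definition K :: "'a cell_structure" where
  "K = \<lparr>cells = cells G \<union> \<iota> ` T,
    cell_dim = (\<lambda>c. if c \<in> cells G then cell_dim G c else 2),
    incidence = (\<lambda>a b.
      if a \<in> cells G \<and> b \<in> cells G then inc a b
      else if a \<in> E \<and> b \<in> \<iota> ` T then circulation (tail x # the_inv_into T \<iota> b) a
      else 0),
    weight = (\<lambda>c. if c \<in> cells G then weight G c else weight G x * t (the_inv_into T \<iota> c))\<rparr>"

lemma finite_T: "finite T"
  using finite_subset[OF T] by simp

lemma \<iota>_notin: "p \<in> T \<Longrightarrow> \<iota> p \<notin> cells G"
  using \<iota>_new by auto

lemma K_simps:
  "cells K = cells G \<union> \<iota> ` T"
  "c \<in> cells G \<Longrightarrow> cell_dim K c = cell_dim G c"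
  "p \<in> T \<Longrightarrow> cell_dim K (\<iota> p) = 2"
  "a \<in> cells G \<Longrightarrow> b \<in> cells G \<Longrightarrow> incidence K a b = inc a b"
  "p \<in> T \<Longrightarrow> incidence K (\<iota> p) b = 0"
  "p \<in> T \<Longrightarrow> a \<in> E \<Longrightarrow> incidence K a (\<iota> p) = circulation (tail x # p) a"
  "p \<in> T \<Longrightarrow> a \<notin> E \<Longrightarrow> incidence K a (\<iota> p) = 0"
  "c \<in> cells G \<Longrightarrow> weight K c = weight G c"
  "p \<in> T \<Longrightarrow> weight K (\<iota> p) = weight G x * t p"
  using \<iota>_notin E_dim by (auto simp: K_def the_inv_into_f_f[OF \<iota>_inj])

lemma dim_G_le: "c \<in> cells G \<Longrightarrow> cell_dim G c \<le> 1"
  using cells_eq V_dim E_dim by auto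

lemma path_facts:
  assumes "p \<in> T"
  shows "p \<in> detours x" "distinct p" "hd p = head x" "last p = tail x" "p \<noteq> []"
    "vertex_path G (head x) p (tail x)" "set p \<subseteq> V" "tail x \<in> set p"
proof -
  show *: "p \<in> detours x" using assms T by blast
  then show "distinct p" "hd p = head x" "last p = tail x" "p \<noteq> []"
      "vertex_path G (head x) p (tail x)" "set p \<subseteq> V"
    by (auto simp: detours_def simple_paths_def vertex_path_def)
  then show "tail x \<in> set p" by (metis last_in_set)
qed

lemma steps_cycle: "p \<in> T \<Longrightarrow> steps (tail x # p) = insert (tail x, head x) (steps p)"
  using path_facts[of p] by (cases p) auto

text \<open>Since \<open>p\<close> uses the edge \<open>x\<close> in neither direction, the closed
  walk traverses no edge both ways and signs do not cancel.\<close>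

lemma cycle_asym:
  assumes p: "p \<in> T" and "(a, b) \<in> steps (tail x # p)"
  shows "(b, a) \<notin> steps (tail x # p)"
  using assms steps_asym[OF path_facts(2)[OF p]] detours_steps[OF x path_facts(1)[OF p]] tail_neq_head[OF x]
  unfolding steps_cycle[OF p] by auto

text \<open>Reversing the orientation of \<open>e\<close> flips both factors, so the products depend
  on the direction of travel only. The opposite signs serve \<open>diamond\<close>.\<close>

lemma cycle_edge:
  assumes p: "p \<in> T" and s: "(a, b) \<in> steps (tail x # p)"
  obtains e where "e \<in> E" "{tail e, head e} = {a, b}"
    "inc a e * circulation (tail x # p) e = -1" "inc b e * circulation (tail x # p) e = 1"
proof -
  have "adjacent G a b"
    using s steps_adjacent[OF path_facts(6)[OF p]] adjacent_ends(1)[OF x]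
    unfolding steps_cycle[OF p] by auto
  then obtain e where e: "e \<in> E" "{tail e, head e} = {a, b}"
    by (auto simp: adjacent_iff)
  have "inc a e * circulation (tail x # p) e = -1 \<and> inc b e * circulation (tail x # p) e = 1"
    using e(2) cycle_asym[OF p s] s tail[OF e(1)] head[OF e(1)]
    by (auto simp: doubleton_eq_iff circulation_def)
  then show ?thesis using e that by blast
qed

lemma face_cycle:
  assumes p: "p \<in> T"
  shows "face K e (\<iota> p) \<longleftrightarrow> e \<in> E \<and>
    ((tail e, head e) \<in> steps (tail x # p) \<or> (head e, tail e) \<in> steps (tail x # p))"
proof (cases "e \<in> E")
  case True
  have "face K e (\<iota> p) \<longleftrightarrow> circulation (tail x # p) e \<noteq> 0"
    using True p K_simps E_dim[OF True] by (auto simp: face_def)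
  then show ?thesis
    using cycle_asym[OF p, of "tail e" "head e"] True by (auto simp: circulation_def)
qed (use K_simps(7)[OF p] in \<open>auto simp: face_def\<close>)

lemma face_G: "z \<in> cells G \<Longrightarrow> face K a z \<longleftrightarrow> face G a z"
  using K_simps(1,4,5) by (auto simp: face_def)

lemma face_x: "p \<in> T \<Longrightarrow> face K x (\<iota> p)"
  using x by (simp add: face_cycle steps_cycle)

lemma circulation_cycle:
  assumes p: "p \<in> T" and e: "e \<in> E"
  shows "circulation (tail x # p) e = of_bool (e = x) + circulation p e"
proof (cases "e = x")
  case True
  then show ?thesis
    using detours_steps[OF x path_facts(1)[OF p]] tail_neq_head[OF x]
    unfolding circulation_def steps_cycle[OF p] by auto
next
  case False
  then have "{tail e, head e} \<noteq> {tail x, head x}"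
    using edge_unique[OF e x] by auto
  then show ?thesis
    using False unfolding circulation_def steps_cycle[OF p] by (auto simp: doubleton_eq_iff)
qed

text \<open>On \<open>p\<close> only the first vertex lacks a predecessor and only the last a
  successor; the closing step supplies both.\<close>

lemma cycle_neighbours:
  assumes p: "p \<in> T" and u: "u \<in> set p"
  obtains a b where "(a, u) \<in> steps (tail x # p)" "(u, b) \<in> steps (tail x # p)"
    "\<And>c. (c, u) \<in> steps (tail x # p) \<Longrightarrow> c = a" "\<And>c. (u, c) \<in> steps (tail x # p) \<Longrightarrow> c = b"
proof -
  note pf = path_facts[OF p]
  have "\<exists>a. (a, u) \<in> steps (tail x # p) \<and> (\<forall>c. (c, u) \<in> steps (tail x # p) \<longrightarrow> c = a)"
  proof (cases "u = head x")
    case True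
    then have "(c, u) \<notin> steps p" for c
      using steps_snd_not_hd[OF pf(2), of c u] pf(3) by auto
    then show ?thesis
      unfolding steps_cycle[OF p] True by (intro exI[of _ "tail x"]) auto
  next
    case False
    then obtain a where a: "(a, u) \<in> steps p"
      using steps_pred_ex[OF u] pf(3) by auto
    show ?thesis
      unfolding steps_cycle[OF p] using a False
      by (intro exI[of _ a]) (auto dest: steps_pred_unique[OF pf(2) _ a])
  qed
  moreover have "\<exists>b. (u, b) \<in> steps (tail x # p) \<and> (\<forall>c. (u, c) \<in> steps (tail x # p) \<longrightarrow> c = b)"
  proof (cases "u = tail x")
    case True
    then have "(u, c) \<notin> steps p" for c
      using steps_fst_not_last[OF pf(2), of u c] pf(4) by auto
    then show ?thesis
      unfolding steps_cycle[OF p] True by (intro exI[of _ "head x"]) auto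
  next
    case False
    then obtain b where b: "(u, b) \<in> steps p"
      using steps_succ_ex[OF u] pf(4) by auto
    show ?thesis
      unfolding steps_cycle[OF p] using b False
      by (intro exI[of _ b]) (auto dest: steps_succ_unique[OF pf(2) _ b])
  qed
  ultimately show ?thesis using that by blast
qed

lemma steps_cycle_subset: "p \<in> T \<Longrightarrow> steps (tail x # p) \<subseteq> set p \<times> set p"
  using steps_subset[of p] path_facts[of p] hd_in_set[of p] list.set_sel(2)[of p]
  by (fastforce simp: steps_cycle)

section \<open>Cell complex axioms and Laplacian of the filling\<close>

text \<open>The two edges are those of the steps into and out of \<open>u\<close>, with products 1
  and -1 by \<open>cycle_edge\<close>.\<close>

lemma K_diamond:
  assumes p: "p \<in> T" and u: "u \<in> V" and ne: "{e. face K u e \<and> face K e (\<iota> p)} \<noteq> {}"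
  shows "card {e. face K u e \<and> face K e (\<iota> p)} = 2 \<and>
    {-1, 1} \<subseteq> {incidence K u e * incidence K e (\<iota> p) |e. e \<in> cells K}"
proof -
  let ?S = "steps (tail x # p)"
  have face_u: "face K u e \<longleftrightarrow> u = tail e \<or> u = head e" if "e \<in> E" for e
    using face_edge[OF that] face_G[of e u] E_dim[OF that] by auto
  obtain e where "face K u e" "face K e (\<iota> p)" using ne by auto
  then have "u \<in> set p"
    using face_u steps_cycle_subset[OF p] unfolding face_cycle[OF p] by blast
  obtain a b where ab: "(a, u) \<in> ?S" "(u, b) \<in> ?S"
    "\<And>c. (c, u) \<in> ?S \<Longrightarrow> c = a" "\<And>c. (u, c) \<in> ?S \<Longrightarrow> c = b"
    by (rule cycle_neighbours[OF p \<open>u \<in> set p\<close>]) (rule that)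
  obtain e1 where e1: "e1 \<in> E" "{tail e1, head e1} = {a, u}"
      "inc u e1 * circulation (tail x # p) e1 = 1"
    using cycle_edge[OF p ab(1)] by metis
  obtain e2 where e2: "e2 \<in> E" "{tail e2, head e2} = {u, b}"
      "inc u e2 * circulation (tail x # p) e2 = -1"
    using cycle_edge[OF p ab(2)] by metis
  have "e1 \<noteq> e2" using e1 e2 by auto
  have sub: "{e1, e2} \<subseteq> {e. face K u e \<and> face K e (\<iota> p)}"
    using e1 e2 face_u ab(1,2) by (auto simp: face_cycle[OF p] doubleton_eq_iff)
  have "e \<in> {e1, e2}" if "face K u e" "face K e (\<iota> p)" for e
  proof -
    have e: "e \<in> E" "u = tail e \<or> u = head e" "(tail e, head e) \<in> ?S \<or> (head e, tail e) \<in> ?S"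
      using that face_u by (auto simp: face_cycle[OF p])
    then have "{tail e, head e} = {a, u} \<or> {tail e, head e} = {u, b}"
      using ab(3,4) by blast
    then show ?thesis
      using edge_unique[OF e(1) e1(1)] edge_unique[OF e(1) e2(1)] e1(2) e2(2) by auto
  qed
  then have "{e. face K u e \<and> face K e (\<iota> p)} = {e1, e2}"
    using sub by auto
  moreover have "incidence K u e * incidence K e (\<iota> p) = inc u e * circulation (tail x # p) e"
    if "e \<in> E" for e
    using that K_simps(4)[of u e] K_simps(6)[OF p that] V_dim[OF u] E_dim[OF that] by simp
  then have "incidence K u e1 * incidence K e1 (\<iota> p) = 1" "incidence K u e2 * incidence K e2 (\<iota> p) = -1"
    using e1 e2 by auto
  moreover have "e1 \<in> cells K" "e2 \<in> cells K"
    using e1 e2 E_dim K_simps(1) by auto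
  ultimately show ?thesis
    using \<open>e1 \<noteq> e2\<close> by (simp, metis)
qed

text \<open>Walking along \<open>p\<close> through alternating vertices and edges joins every
  boundary edge to \<open>head x\<close>; two such walks are glued there.\<close>

lemma K_boundary_connected:
  assumes p: "p \<in> T" and y: "face K y (\<iota> p)" and y': "face K y' (\<iota> p)"
  shows "\<exists>(n::nat) s. s 0 = y \<and> s n = y' \<and>
    (\<forall>i\<le>n. s i \<in> {u. face K u (\<iota> p)} \<union> {v. \<exists>u. face K v u \<and> face K u (\<iota> p)}) \<and>
    (\<forall>i\<in>{1..n}. incidence K (s i) (s (i - 1)) + incidence K (s (i - 1)) (s i) \<noteq> 0)"
proof -
  define F where "F = {u. face K u (\<iota> p)} \<union> {v. \<exists>u. face K v u \<and> face K u (\<iota> p)}"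
  define R where "R a b \<longleftrightarrow> a \<in> F \<and> b \<in> F \<and> incidence K a b + incidence K b a \<noteq> 0" for a b
  have sym: "R b a" if "R a b" for a b
    using that by (auto simp: R_def add.commute)
  have ends: "R u e" if "face K e (\<iota> p)" "u = tail e \<or> u = head e" for u e
  proof -
    have e: "e \<in> E" using that by (simp add: face_cycle[OF p])
    then have "face G u e" using face_edge[OF e] that(2) by auto
    then have u: "face K u e" "u \<in> V" using face_G E_dim[OF e] tail(1)[OF e] head(1)[OF e] that(2) by auto
    have "incidence K u e \<noteq> 0" using u by (simp add: face_def)
    moreover have "e \<notin> V" using E_dim[OF e] V_dim[of e] by auto
    then have "incidence K e u = 0"
      using K_simps(4)[of e u] inc_eq_0[of e u] E_dim[OF e] V_dim[OF u(2)] by simp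
    ultimately show ?thesis using u that(1) by (auto simp: R_def F_def)
  qed
  have step: "R\<^sup>*\<^sup>* a b" if "(a, b) \<in> steps p" for a b
  proof -
    have s: "(a, b) \<in> steps (tail x # p)" using that by (simp add: steps_cycle[OF p])
    obtain e where e: "e \<in> E" "{tail e, head e} = {a, b}" using cycle_edge[OF p s] by metis
    then have "face K e (\<iota> p)" using s by (auto simp: face_cycle[OF p] doubleton_eq_iff)
    then have "R a e" "R e b" using ends sym e by (auto simp: doubleton_eq_iff)
    then show ?thesis by auto
  qed
  have "R\<^sup>*\<^sup>* (head x) u" if "u \<in> set p" for u
  proof -
    have "(head x, u) \<in> (steps p)\<^sup>*" using steps_reachable[OF that] path_facts(3)[OF p] by simp
    then show ?thesis by induction (auto intro: rtranclp_trans step)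
  qed
  then have reach: "R\<^sup>*\<^sup>* (head x) e" if "face K e (\<iota> p)" for e
    using ends[OF that] that steps_cycle_subset[OF p]
    by (metis face_cycle[OF p] SigmaD1 rtranclp.rtrancl_into_rtrancl subsetD)
  have "symp R\<^sup>*\<^sup>*" using sym by (intro symp_rtranclp sympI)
  then have "R\<^sup>*\<^sup>* y y'"
    using reach[OF y] reach[OF y'] by (meson rtranclp_trans sympD)
  then obtain n where "(R ^^ n) y y'" using rtranclp_imp_relpowp by metis
  then obtain s where s: "s 0 = y" "s n = y'" "\<And>i. i < n \<Longrightarrow> R (s i) (s (Suc i))"
    by (auto simp: relpowp_fun_conv)
  have "s i \<in> F" if "i \<le> n" for i
  proof (cases i)
    case 0
    then show ?thesis using s(1) y by (simp add: F_def)
  next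
    case (Suc j)
    then show ?thesis using s(3)[of j] that by (simp add: R_def)
  qed
  moreover have "incidence K (s i) (s (i - 1)) + incidence K (s (i - 1)) (s i) \<noteq> 0" if "i \<in> {1..n}" for i
  proof -
    have "R (s (i - 1)) (s i)" using s(3)[of "i - 1"] that by (cases i) auto
    then show ?thesis by (simp add: R_def add.commute)
  qed
  ultimately show ?thesis using s(1,2) unfolding F_def by blast
qed

text \<open>Apart from \<open>x\<close>, the faces of a cell are the undirected steps of its path,
  and these with the ends determine the path.\<close>

lemma same_faces_eq:
  assumes p: "p \<in> T" and q: "q \<in> T" and eq: "{e. face K e (\<iota> p)} = {e. face K e (\<iota> q)}"
  shows "p = q"
proof -
  have U: "(\<lambda>(a, b). {a, b}) ` steps r = (\<lambda>e. {tail e, head e}) ` ({e. face K e (\<iota> r)} - {x})"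
    if r: "r \<in> T" for r
  proof (intro equalityI subsetI)
    fix U assume "U \<in> (\<lambda>(a, b). {a, b}) ` steps r"
    then obtain a b where ab: "(a, b) \<in> steps r" "U = {a, b}" by auto
    then have s: "(a, b) \<in> steps (tail x # r)" by (simp add: steps_cycle[OF r])
    obtain e where e: "e \<in> E" "{tail e, head e} = {a, b}" using cycle_edge[OF r s] by metis
    have "face K e (\<iota> r)" using e s by (auto simp: face_cycle[OF r] doubleton_eq_iff)
    moreover have "e \<noteq> x"
      using e(2) ab(1) detours_steps[OF x path_facts(1)[OF r]] by (auto simp: doubleton_eq_iff)
    ultimately show "U \<in> (\<lambda>e. {tail e, head e}) ` ({e. face K e (\<iota> r)} - {x})"
      using e(2) ab(2) by auto
  next
    fix U assume "U \<in> (\<lambda>e. {tail e, head e}) ` ({e. face K e (\<iota> r)} - {x})"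
    then obtain e where e: "face K e (\<iota> r)" "e \<noteq> x" "U = {tail e, head e}" by auto
    then have "e \<in> E" by (simp add: face_cycle[OF r])
    then have "{tail e, head e} \<noteq> {tail x, head x}" using edge_unique[OF _ x] e(2) by blast
    then have "(tail e, head e) \<in> steps r \<or> (head e, tail e) \<in> steps r"
      using e(1) by (auto simp: face_cycle[OF r] steps_cycle[OF r])
    then show "U \<in> (\<lambda>(a, b). {a, b}) ` steps r"
      using e(3) by (force simp: insert_commute)
  qed
  show ?thesis
    using path_facts[OF p] path_facts[OF q] U[OF p] U[OF q] eq by (intro distinct_path_eqI) simp_all
qed

lemma cells_of_dim_K: "cells_of_dim K 0 = V" "cells_of_dim K 1 = E"
proof -
  have "cells_of_dim K k = cells_of_dim G k" if "k \<le> 1" for k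
    using that K_simps(1,2,3) by (auto simp: cells_of_dim_def)
  then show "cells_of_dim K 0 = V" "cells_of_dim K 1 = E" by (auto simp: E_def)
qed

lemma cell_complex_K: "cell_complex K"
proof
  show "finite (cells K)" using finite_cells finite_T by (simp add: K_simps)
  fix c assume "c \<in> cells K"
  then show "0 < weight K c"
    using weight_pos t_pos E_dim[OF x] by (auto simp: K_simps)
next
  fix a z assume az: "a \<in> cells K" "z \<in> cells K"
  show "incidence K a z \<in> {-1, 0, 1}"
  proof (cases "z \<in> cells G")
    case True
    then show ?thesis
      using az(1) incidence_values[of a z] by (auto simp: K_simps)
  next
    case False
    then obtain p where "p \<in> T" "z = \<iota> p" using az by (auto simp: K_simps)
    then show ?thesis
      by (cases "a \<in> E") (auto simp: K_simps circulation_def)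
  qed
  show "incidence K a z = 0" if dim: "cell_dim K z \<noteq> cell_dim K a + 1"
  proof (cases "z \<in> cells G")
    case True
    then show ?thesis
      using az(1) incidence_dim[of a z] dim by (auto simp: K_simps)
  next
    case False
    then obtain p where "p \<in> T" "z = \<iota> p" using az by (auto simp: K_simps)
    then show ?thesis
      using dim E_dim[of a] by (cases "a \<in> E") (auto simp: K_simps)
  qed
next
  fix z assume z: "z \<in> cells K" "1 \<le> cell_dim K z"
  show "\<exists>a. face K a z"
  proof (cases "z \<in> cells G")
    case True
    then show ?thesis using z ex_face[of z] face_G by (auto simp: K_simps)
  next
    case False
    then show ?thesis using z face_x by (auto simp: K_simps)
  qed
next
  fix e assume "e \<in> cells_of_dim K 1"
  then have e: "e \<in> E" by (simp add: cells_of_dim_K del: One_nat_def)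
  have "incidence K w e = inc w e" if "w \<in> V" for w
    using that e V_dim E_dim by (simp add: K_simps)
  then show "(\<exists>!w. w \<in> cells_of_dim K 0 \<and> incidence K w e = 1) \<and>
      (\<exists>!w. w \<in> cells_of_dim K 0 \<and> incidence K w e = -1)"
    using edge_vertices[OF e[unfolded E_def]] unfolding cells_of_dim_K by metis
next
  fix u z
  assume uz: "u \<in> cells K" "z \<in> cells K" "cell_dim K z = cell_dim K u + 2"
    "{e. face K u e \<and> face K e z} \<noteq> {}"
  \<comment> \<open>The gap of two dimensions leaves only a new cell \<open>z\<close> over a vertex
    \<open>u\<close>.\<close>
  have "z \<notin> cells G" using uz(3) dim_G_le[of z] K_simps(2)[of z] by auto
  then obtain p where p: "p \<in> T" "z = \<iota> p" using uz(2) by (auto simp: K_simps)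
  then have "cell_dim K u = 0" using uz(3) by (simp add: K_simps)
  then have "u \<in> V" using uz(1) cells_of_dim_K(1) by (auto simp: cells_of_dim_def)
  then show "card {e. face K u e \<and> face K e z} = 2 \<and>
      {-1, 1} \<subseteq> {incidence K u e * incidence K e z |e. e \<in> cells K}"
    using K_diamond[OF p(1)] uz(4) p(2) by blast
next
  fix z a b
  assume z: "z \<in> cells K" "2 \<le> cell_dim K z" and ab: "face K a z" "face K b z"
  have "z \<notin> cells G" using z(2) dim_G_le[of z] K_simps(2)[of z] by auto
  then obtain p where p: "p \<in> T" "z = \<iota> p" using z(1) by (auto simp: K_simps)
  show "\<exists>(n::nat) s. s 0 = a \<and> s n = b \<and>
      (\<forall>i\<le>n. s i \<in> {u. face K u z} \<union> {v. \<exists>u. face K v u \<and> face K u z}) \<and>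
      (\<forall>i\<in>{1..n}. incidence K (s i) (s (i - 1)) + incidence K (s (i - 1)) (s i) \<noteq> 0)"
    using K_boundary_connected[OF p(1)] ab unfolding p(2) by blast
next
  fix z z'
  assume z: "z \<in> cells K" "z' \<in> cells K" "{a. face K a z} = {a. face K a z'}" "1 \<le> cell_dim K z"
  \<comment> \<open>New cells have \<open>x\<close> as a face and cells of \<open>G\<close> do not,
    so their boundaries differ.\<close>
  have x_no_face: "\<not> face K x c" if "c \<in> cells G" for c
    using that face_G[OF that] incidence_dim[of x c] E_dim[OF x] dim_G_le[OF that] by (auto simp: face_def)
  consider "z \<in> cells G" "z' \<in> cells G" | p where "p \<in> T" "z = \<iota> p" "z' \<in> cells G"
    | p where "p \<in> T" "z' = \<iota> p" "z \<in> cells G" | p q where "p \<in> T" "q \<in> T" "z = \<iota> p" "z' = \<iota> q"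
    using z(1,2) by (auto simp: K_simps)
  then show "z = z'"
  proof cases
    case 1
    then show ?thesis using boundary_determines[of z z'] z face_G by (simp add: K_simps)
  next
    case (2 p)
    then show ?thesis using face_x x_no_face z(3) by blast
  next
    case (3 p)
    then show ?thesis using face_x x_no_face z(3) by blast
  next
    case (4 p q)
    then show ?thesis using same_faces_eq z(3) by blast
  qed
qed

lemma skeleton_K: "has_one_skeleton K G"
  using cells_eq unfolding has_one_skeleton_def cells_of_dim_K E_def[symmetric]
  by (simp add: K_simps)

sublocale extension: complex_extension G K
  using graph_complex_axioms cell_complex_K skeleton_K
  by (simp add: complex_extension_def complex_extension_axioms_def)

text \<open>Only new cells lie above \<open>x\<close>, with incidence 1 as detours avoid
  \<open>x\<close>; the factor \<open>weight G x\<close> in their weights cancels the denominator of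
  \<open>upper\<close>.\<close>

lemma upper_K:
  assumes y: "y \<in> E"
  shows "extension.upper x y = (\<Sum>p\<in>T. t p * (of_bool (y = x) + circulation p y))"
proof -
  have "incidence K x z = 0" if "z \<in> cells G" for z
    using that incidence_dim[of x z] E_dim[OF x] dim_G_le[OF that] by (simp add: K_simps)
  then have "(\<Sum>z\<in>cells K. incidence K x z * incidence K y z * weight K z) =
      (\<Sum>z\<in>\<iota> ` T. incidence K x z * incidence K y z * weight K z)"
    using finite_T finite_cells by (intro sum.mono_neutral_right) (auto simp: K_simps)
  also have "\<dots> = (\<Sum>p\<in>T. incidence K x (\<iota> p) * incidence K y (\<iota> p) * weight K (\<iota> p))"
    by (simp add: sum.reindex[OF \<iota>_inj])
  also have "\<dots> = (\<Sum>p\<in>T. weight G x * (t p * (of_bool (y = x) + circulation p y)))"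
    using T x y detours_circulation[OF x]
    by (intro sum.cong) (auto simp: K_simps circulation_cycle subset_iff)
  also have "\<dots> = weight G x * (\<Sum>p\<in>T. t p * (of_bool (y = x) + circulation p y))"
    by (simp add: sum_distrib_left)
  finally show ?thesis
    using weight_pos E_dim[OF x] by (simp add: extension.upper_def order_less_imp_not_eq2)
qed

end

section \<open>Equality of the Ollivier curvature and the largest Forman curvature\<close>

theorem corollary7p6:
  fixes G :: "'a::infinite cell_structure" and \<omega> :: "'a \<Rightarrow> real" and x :: 'a
  assumes "cell_complex G"
    and "complex_dim G = 1"
    and "\<And>y. y \<in> cells G \<Longrightarrow> 0 < \<omega> y"
    and "nondegenerate G \<omega>"
    and "x \<in> cells_of_dim G 1"
  shows "(\<exists>K. cell_complex K \<and> has_one_skeleton K G \<and>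
              ollivier_curvature G \<omega> x = forman_curvature K \<omega> x) \<and>
         (\<forall>K. cell_complex K \<and> has_one_skeleton K G \<longrightarrow>
              forman_curvature K \<omega> x \<le> ollivier_curvature G \<omega> x)"
proof -
  interpret cell_complex G by fact
  have "cell_dim G c \<le> 1" if "c \<in> cells G" for c
    using that finite_cells assms(2) unfolding complex_dim_def by (metis Max_ge finite_imageI imageI)
  then have "cells G = cells_of_dim G 0 \<union> cells_of_dim G 1"
    by (auto simp: cells_of_dim_def le_Suc_eq)
  then interpret weighted_graph_complex G \<omega>
    using assms by unfold_locales auto
  have x: "x \<in> E" using assms(5) by (simp add: E_def)
  have \<omega>x: "0 < \<omega> x" using \<omega>_pos E_dim[OF x] by blast
  let ?val = "\<lambda>f. coboundary G (adj_coboundary G (coboundary G f)) x"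
  have adm: "f \<in> fun_space G \<and> coboundary G f x = \<omega> x \<and> (\<forall>y\<in>cells G. \<bar>coboundary G f y\<bar> \<le> \<omega> y)
      \<longleftrightarrow> admissible x f" for f
    using \<omega>_pos cells_eq
    by (auto simp: admissible_def coboundary_edge coboundary_vertex x ball_Un less_imp_le)
  have olliv: "\<omega> x * ollivier_curvature G \<omega> x = Inf {?val f |f. admissible x f}" (is "_ = Inf ?A")
    unfolding ollivier_curvature_def adm using \<omega>x by simp
  have weak: "\<omega> x * forman_curvature K \<omega> x \<le> ?val f"
    if "cell_complex K" "has_one_skeleton K G" "admissible x f" for K f
  proof -
    interpret complex_extension G K
      using that graph_complex_axioms by (simp add: complex_extension_def complex_extension_axioms_def)
    show ?thesis
      using that(3) x \<omega>x by (intro forman_le_lower_laplacian) (auto simp: admissible_def)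
  qed
  have le: "forman_curvature K \<omega> x \<le> ollivier_curvature G \<omega> x"
    if "cell_complex K" "has_one_skeleton K G" for K
  proof -
    have "?A \<noteq> {}" using admissible_exists[OF x] by blast
    then have "\<omega> x * forman_curvature K \<omega> x \<le> Inf ?A"
      using weak[OF that] by (intro cInf_greatest) auto
    then show ?thesis unfolding olliv[symmetric] by (rule mult_left_le_imp_le) (rule \<omega>x)
  qed
  \<comment> \<open>As a complex over itself, \<open>G\<close> yields a lower bound for the Ollivier
    set by weak duality.\<close>
  have "has_one_skeleton G G"
    using cells_eq by (simp add: has_one_skeleton_def E_def)
  then have bdd: "bdd_below ?A"
    using weak[OF assms(1)] by (intro bdd_belowI) auto
  \<comment> \<open>The infimum itself serves as \<open>M\<close> in the linear program.\<close>
  have "Inf ?A \<le> (\<Sum>y\<in>E. lower x y * (f (head y) - f (tail y)))" if "admissible x f" for f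
    unfolding lower_laplacian_eq[OF x, symmetric] using that bdd by (intro cInf_lower) auto
  then obtain t where t: "\<And>p. p \<in> detours x \<Longrightarrow> 0 \<le> t p"
    "Inf ?A \<le> (lower x x + (\<Sum>p\<in>detours x. t p)) * \<omega> x -
       (\<Sum>y\<in>E - {x}. \<bar>lower x y + (\<Sum>p\<in>detours x. t p * circulation p y)\<bar> * \<omega> y)"
    using detour_weights[OF x] by blast
  \<comment> \<open>Detours of weight 0 cannot get a cell; by \<open>sum_T\<close> they do not
    affect the sums.\<close>
  define T where "T = {p \<in> detours x. 0 < t p}"
  \<comment> \<open>An infinite type leaves room to name the new cells.\<close>
  have "infinite (- cells G)"
    using finite_cells infinite_UNIV by (simp add: Compl_eq_Diff_UNIV)
  then obtain B where B: "finite B" "card B = card T" "B \<subseteq> - cells G"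
    using infinite_arbitrarily_large by blast
  then obtain \<iota> where \<iota>: "bij_betw \<iota> T B"
    using finite_same_card_bij[of T B] by (auto simp: T_def)
  interpret detour_filling G \<omega> x T \<iota> t
    using x \<iota> B(3) by unfold_locales (auto simp: T_def bij_betw_def)
  have sum_T: "(\<Sum>p\<in>T. t p * h p) = (\<Sum>p\<in>detours x. t p * h p)" for h
    using t(1) by (intro sum.mono_neutral_left) (force simp: T_def)+
  have "extension.upper x x = (\<Sum>p\<in>detours x. t p)"
    using upper_K[OF x] sum_T[of "\<lambda>_. 1"] detours_circulation[OF x] by (simp add: sum_T)
  moreover have "extension.upper x y = (\<Sum>p\<in>detours x. t p * circulation p y)" if "y \<in> E - {x}" for y
    using upper_K[of y] that by (simp add: sum_T)
  \<comment> \<open>The filling attains at least the infimum, the inequality opposite to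
    \<open>le\<close>.\<close>
  ultimately have "Inf ?A \<le> \<omega> x * forman_curvature K \<omega> x"
    using t(2) unfolding extension.forman_eq[of x \<omega>, OF x \<omega>x] by simp
  then have "ollivier_curvature G \<omega> x \<le> forman_curvature K \<omega> x"
    unfolding olliv[symmetric] by (rule mult_left_le_imp_le) (rule \<omega>x)
  then show ?thesis
    using le cell_complex_K skeleton_K by (meson order_antisym)
qed

end
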